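(* Let $\mathfrak U$ be a Grothendieck universe and let $T_{\mathrm{Ab}}$ be the theory of commutative groups in the language $(+,-,0)$. The category $\mathbb{M}\mathrm{od}_{\mathfrak U}(T_{\mathrm{Ab}})$ of Abelian groups whose underlying set belongs to $\mathfrak U$ (with all group homomorphisms as morphisms) is universal: every small category that is $L_{\mathrm{cat}}$-elementarily equivalent to $\mathbb{M}\mathrm{od}_{\mathfrak U}(T_{\mathrm{Ab}})$ embeds in it.
   Context: A Grothendieck universe is a set $\mathfrak U$ that is transitive, closed under power sets, closed under unions $\bigcup_{i\in I}x_i$ with $I\in\mathfrak U$ and all $x_i\in\mathfrak U$, and contains $\omega$. $L_{\mathrm{cat}}$ is the two-sorted language with an object sort and a morphism sort, a binary (partial) function $\circ$ on morphisms (composition), unary functions dom and rng from morphisms to objects, and a unary function Id from objects to morphisms (identity morphism). Composition is regarded as a partial function, defined only on composable pairs (equivalently, one uses its graph as a ternary relation). Every category is an $L_{\mathrm{cat}}$-structure. A category is small if both its set of objects and its set of morphisms are elements of $\mathfrak U$. An embedding of categories is a functor that is injective on objects and on morphisms. A structure whose underlying set is a subset of $\mathfrak U$ is universal if every small structure elementarily equivalent to it embeds in it. *)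

theory Defs
  imports "HOL-Algebra.Group"
begin

section \<open>Grothendieck universes\<close>

text \<open>
  Sets are the elements of a type carrying an extensional, well-founded membership relation
  (\<open>elts x\<close> is the set of members of \<open>x\<close>) with unordered pairs; nothing else is assumed about
  the ambient sets.
  A universe is a HOL set of such elements. Families and subsets are
  arbitrary HOL functions and HOL subsets, so that the closure conditions below are the full ones
  and not merely their first-order instances.
\<close>

class sets =
  fixes elts :: "'a \<Rightarrow> 'a set"
  assumes elts_inject: "elts x = elts y \<Longrightarrow> x = y"
    and wf_elts: "wf {(x, y). x \<in> elts y}"
    and pairing: "\<exists>p. elts p = {x, y}"

definition is_Pow :: "'v::sets \<Rightarrow> 'v \<Rightarrow> bool" where
  "is_Pow p x \<longleftrightarrow> elts ` elts p = Pow (elts x)"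

definition is_omega :: "'v::sets \<Rightarrow> bool" where
  "is_omega w \<longleftrightarrow> (\<exists>num :: nat \<Rightarrow> 'v.
      elts (num 0) = {} \<and>
      (\<forall>k. elts (num (Suc k)) = insert (num k) (elts (num k))) \<and>
      elts w = range num)"

definition grothendieck_universe :: "'v::sets set \<Rightarrow> bool" where
  "grothendieck_universe U \<longleftrightarrow>
     (\<forall>x\<in>U. elts x \<subseteq> U) \<and>
     (\<forall>x\<in>U. \<exists>p\<in>U. is_Pow p x) \<and>
     (\<forall>I\<in>U. \<forall>x. (\<forall>i\<in>elts I. x i \<in> U) \<longrightarrow> (\<exists>u\<in>U. elts u = (\<Union>i\<in>elts I. elts (x i)))) \<and>
     (\<exists>w\<in>U. is_omega w)"

text \<open>
  \<open>vset X\<close> is the set with extension \<open>X\<close>. It is meaningful only if there is one, as for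
  one- and two-element \<open>X\<close> (so that Kuratowski pairs always exist) and for every \<open>X\<close> contained
  in a member of a Grothendieck universe.
\<close>

definition vset :: "'v set \<Rightarrow> 'v::sets" where
  "vset X = (THE v. elts v = X)"

definition vpair :: "'v \<Rightarrow> 'v \<Rightarrow> 'v::sets" where
  "vpair a b = vset {vset {a}, vset {a, b}}"

definition vfst :: "'v \<Rightarrow> 'v::sets" where
  "vfst p = (THE a. \<exists>b. p = vpair a b)"

definition vsnd :: "'v \<Rightarrow> 'v::sets" where
  "vsnd p = (THE b. \<exists>a. p = vpair a b)"


section \<open>Structures for the language of categories\<close>

text \<open>\<open>Cmp S g f\<close> is the composite of \<open>g\<close> after \<open>f\<close>, and \<open>None\<close> where it is undefined.\<close>

record ('o, 'm) lcat =
  Obj :: "'o set"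
  Mor :: "'m set"
  Dom :: "'m \<Rightarrow> 'o"
  Rng :: "'m \<Rightarrow> 'o"
  Idm :: "'o \<Rightarrow> 'm"
  Cmp :: "'m \<Rightarrow> 'm \<Rightarrow> 'm option"

definition lcat_structure :: "('o, 'm) lcat \<Rightarrow> bool" where
  "lcat_structure S \<longleftrightarrow>
     Dom S \<in> Mor S \<rightarrow> Obj S \<and> Rng S \<in> Mor S \<rightarrow> Obj S \<and> Idm S \<in> Obj S \<rightarrow> Mor S \<and>
     (\<forall>g f h. Cmp S g f = Some h \<longrightarrow> g \<in> Mor S \<and> f \<in> Mor S \<and> h \<in> Mor S)"

definition category :: "('o, 'm) lcat \<Rightarrow> bool" where
  "category S \<longleftrightarrow> lcat_structure S \<and>
     (\<forall>g\<in>Mor S. \<forall>f\<in>Mor S. Cmp S g f \<noteq> None \<longleftrightarrow> Dom S g = Rng S f) \<and>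
     (\<forall>g f h. Cmp S g f = Some h \<longrightarrow> Dom S h = Dom S f \<and> Rng S h = Rng S g) \<and>
     (\<forall>x\<in>Obj S. Dom S (Idm S x) = x \<and> Rng S (Idm S x) = x) \<and>
     (\<forall>f\<in>Mor S. Cmp S f (Idm S (Dom S f)) = Some f \<and> Cmp S (Idm S (Rng S f)) f = Some f) \<and>
     (\<forall>h g f hg gf. Cmp S h g = Some hg \<and> Cmp S g f = Some gf \<longrightarrow> Cmp S hg f = Cmp S h gf)"

definition is_functor ::
    "('o, 'm) lcat \<Rightarrow> ('p, 'n) lcat \<Rightarrow> ('o \<Rightarrow> 'p) \<Rightarrow> ('m \<Rightarrow> 'n) \<Rightarrow> bool" where
  "is_functor C D F G \<longleftrightarrow> category C \<and> category D \<and>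
     F \<in> Obj C \<rightarrow> Obj D \<and> G \<in> Mor C \<rightarrow> Mor D \<and>
     (\<forall>f\<in>Mor C. Dom D (G f) = F (Dom C f) \<and> Rng D (G f) = F (Rng C f)) \<and>
     (\<forall>x\<in>Obj C. G (Idm C x) = Idm D (F x)) \<and>
     (\<forall>g f h. Cmp C g f = Some h \<longrightarrow> Cmp D (G g) (G f) = Some (G h))"

definition embeds :: "('o, 'm) lcat \<Rightarrow> ('p, 'n) lcat \<Rightarrow> bool" where
  "embeds C D \<longleftrightarrow> (\<exists>F G. is_functor C D F G \<and> inj_on F (Obj C) \<and> inj_on G (Mor C))"


section \<open>First-order logic of categories\<close>

text \<open>
  There are separate object and morphism variables, each indexed by natural numbers. Composition
  enters through its graph: \<open>FCmp s t u\<close> says that the composite of \<open>s\<close> after \<open>t\<close> is defined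
  and equals \<open>u\<close>.
\<close>

datatype oterm = OVar nat | TDom mterm | TRng mterm
  and mterm = MVar nat | TId oterm

datatype fm =
    EqO oterm oterm
  | EqM mterm mterm
  | FCmp mterm mterm mterm
  | Neg fm
  | Conj fm fm
  | AllO nat fm
  | AllM nat fm

primrec oval :: "('o, 'm) lcat \<Rightarrow> (nat \<Rightarrow> 'o) \<Rightarrow> (nat \<Rightarrow> 'm) \<Rightarrow> oterm \<Rightarrow> 'o"
  and mval :: "('o, 'm) lcat \<Rightarrow> (nat \<Rightarrow> 'o) \<Rightarrow> (nat \<Rightarrow> 'm) \<Rightarrow> mterm \<Rightarrow> 'm" where
  "oval S a b (OVar n) = a n"
| "oval S a b (TDom t) = Dom S (mval S a b t)"
| "oval S a b (TRng t) = Rng S (mval S a b t)"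
| "mval S a b (MVar n) = b n"
| "mval S a b (TId t) = Idm S (oval S a b t)"

primrec sat :: "('o, 'm) lcat \<Rightarrow> (nat \<Rightarrow> 'o) \<Rightarrow> (nat \<Rightarrow> 'm) \<Rightarrow> fm \<Rightarrow> bool" where
  "sat S a b (EqO s t) \<longleftrightarrow> oval S a b s = oval S a b t"
| "sat S a b (EqM s t) \<longleftrightarrow> mval S a b s = mval S a b t"
| "sat S a b (FCmp s t u) \<longleftrightarrow> Cmp S (mval S a b s) (mval S a b t) = Some (mval S a b u)"
| "sat S a b (Neg p) \<longleftrightarrow> \<not> sat S a b p"
| "sat S a b (Conj p q) \<longleftrightarrow> sat S a b p \<and> sat S a b q"
| "sat S a b (AllO n p) \<longleftrightarrow> (\<forall>x\<in>Obj S. sat S (a(n := x)) b p)"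
| "sat S a b (AllM n p) \<longleftrightarrow> (\<forall>f\<in>Mor S. sat S a (b(n := f)) p)"

primrec oterm_ovars :: "oterm \<Rightarrow> nat set" and mterm_ovars :: "mterm \<Rightarrow> nat set" where
  "oterm_ovars (OVar n) = {n}"
| "oterm_ovars (TDom t) = mterm_ovars t"
| "oterm_ovars (TRng t) = mterm_ovars t"
| "mterm_ovars (MVar n) = {}"
| "mterm_ovars (TId t) = oterm_ovars t"

primrec oterm_mvars :: "oterm \<Rightarrow> nat set" and mterm_mvars :: "mterm \<Rightarrow> nat set" where
  "oterm_mvars (OVar n) = {}"
| "oterm_mvars (TDom t) = mterm_mvars t"
| "oterm_mvars (TRng t) = mterm_mvars t"
| "mterm_mvars (MVar n) = {n}"
| "mterm_mvars (TId t) = oterm_mvars t"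

primrec free_ovars :: "fm \<Rightarrow> nat set" where
  "free_ovars (EqO s t) = oterm_ovars s \<union> oterm_ovars t"
| "free_ovars (EqM s t) = mterm_ovars s \<union> mterm_ovars t"
| "free_ovars (FCmp s t u) = mterm_ovars s \<union> mterm_ovars t \<union> mterm_ovars u"
| "free_ovars (Neg p) = free_ovars p"
| "free_ovars (Conj p q) = free_ovars p \<union> free_ovars q"
| "free_ovars (AllO n p) = free_ovars p - {n}"
| "free_ovars (AllM n p) = free_ovars p"

primrec free_mvars :: "fm \<Rightarrow> nat set" where
  "free_mvars (EqO s t) = oterm_mvars s \<union> oterm_mvars t"
| "free_mvars (EqM s t) = mterm_mvars s \<union> mterm_mvars t"
| "free_mvars (FCmp s t u) = mterm_mvars s \<union> mterm_mvars t \<union> mterm_mvars u"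
| "free_mvars (Neg p) = free_mvars p"
| "free_mvars (Conj p q) = free_mvars p \<union> free_mvars q"
| "free_mvars (AllO n p) = free_mvars p"
| "free_mvars (AllM n p) = free_mvars p - {n}"

definition sentence :: "fm \<Rightarrow> bool" where
  "sentence p \<longleftrightarrow> free_ovars p = {} \<and> free_mvars p = {}"

text \<open>The truth value of a sentence does not depend on the variable assignment.\<close>

definition models :: "('o, 'm) lcat \<Rightarrow> fm \<Rightarrow> bool" where
  "models S p \<longleftrightarrow> (\<forall>a b. sat S a b p)"

definition elementarily_equivalent :: "('o, 'm) lcat \<Rightarrow> ('p, 'n) lcat \<Rightarrow> bool" where
  "elementarily_equivalent S T \<longleftrightarrow> (\<forall>p. sentence p \<longrightarrow> (models S p \<longleftrightarrow> models T p))"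


section \<open>Universal structures\<close>

definition small :: "'v::sets set \<Rightarrow> ('v, 'v) lcat \<Rightarrow> bool" where
  "small U C \<longleftrightarrow> (\<exists>x\<in>U. elts x = Obj C) \<and> (\<exists>y\<in>U. elts y = Mor C)"

text \<open>
  The quantification is over all structures for the language. A structure elementarily
  equivalent to a category is itself a category, so for a category \<open>S\<close> it amounts to
  quantifying over the small categories.
\<close>

definition universal :: "'v::sets set \<Rightarrow> ('v, 'v) lcat \<Rightarrow> bool" where
  "universal U S \<longleftrightarrow> lcat_structure S \<and> Obj S \<subseteq> U \<and> Mor S \<subseteq> U \<and>
     (\<forall>C. lcat_structure C \<and> small U C \<and> elementarily_equivalent C S \<longrightarrow> embeds C S)"


section \<open>The category of Abelian groups in a universe\<close>

text \<open>
  An Abelian group is coded as the tuple \<open>(A, +, -, 0)\<close> of its underlying set, the graphs of its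
  operations, and its neutral element, and a homomorphism as the triple of the codes of its source
  and target and its graph. Two records that differ only outside their carriers have the same code.
  The library writes the group operation multiplicatively.
\<close>

definition ab_groups :: "'v::sets set \<Rightarrow> 'v monoid set" where
  "ab_groups U = {G. comm_group G \<and> (\<exists>A\<in>U. elts A = carrier G)}"

definition code_group :: "'v monoid \<Rightarrow> 'v::sets" where
  "code_group G =
     vpair (vset (carrier G))
       (vpair (vset {vpair (vpair x y) (x \<otimes>\<^bsub>G\<^esub> y) |x y. x \<in> carrier G \<and> y \<in> carrier G})
         (vpair (vset {vpair x (inv\<^bsub>G\<^esub> x) |x. x \<in> carrier G})
           \<one>\<^bsub>G\<^esub>))"

definition code_hom :: "'v monoid \<Rightarrow> 'v monoid \<Rightarrow> ('v \<Rightarrow> 'v) \<Rightarrow> 'v::sets" where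
  "code_hom G H f =
     vpair (code_group G) (vpair (code_group H) (vset {vpair x (f x) |x. x \<in> carrier G}))"

definition source :: "'v \<Rightarrow> 'v::sets" where "source m = vfst m"
definition target :: "'v \<Rightarrow> 'v::sets" where "target m = vfst (vsnd m)"
definition graph :: "'v \<Rightarrow> 'v::sets" where "graph m = vsnd (vsnd m)"

definition hom_codes :: "'v::sets set \<Rightarrow> 'v set" where
  "hom_codes U = {code_hom G H f |G H f. G \<in> ab_groups U \<and> H \<in> ab_groups U \<and> f \<in> hom G H}"

definition Ab :: "'v::sets set \<Rightarrow> ('v, 'v) lcat" where
  "Ab U = \<lparr>
     Obj = code_group ` ab_groups U,
     Mor = hom_codes U,
     Dom = source,
     Rng = target,
     Idm = (\<lambda>A. vpair A (vpair A (vset {vpair x x |x. x \<in> elts (vfst A)}))),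
     Cmp = (\<lambda>g f.
       if g \<in> hom_codes U \<and> f \<in> hom_codes U \<and> source g = target f
       then Some (vpair (source f) (vpair (target g)
              (vset {vpair x z |x z. \<exists>y. vpair x y \<in> elts (graph f) \<and> vpair y z \<in> elts (graph g)})))
       else None)\<rparr>"

end

theory Submission
  imports Defs "HOL-Library.Nat_Bijection"
begin

text \<open>
  In the category of Abelian groups, \<open>\<int>\<close> separates morphisms, and the diagonal
  \<open>\<int> \<rightarrow> \<int> \<oplus> \<int>\<close> makes it a cogroup: for every \<open>A\<close> it induces the pointwise addition on
  \<open>Hom(\<int>, A)\<close>. That some object carries a separating commutative cogroup structure is
  expressed by a single first-order sentence, so every structure \<open>C\<close> elementarily equivalent to
  the category of Abelian groups is a category with such an object \<open>Z\<close>. The representable functor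
  \<open>Hom(Z, -)\<close> then takes values in Abelian groups and is faithful. It is injective on objects,
  because \<open>Hom(Z, A)\<close> is a nonempty set of morphisms which all have codomain \<open>A\<close>.
\<close>

section \<open>Sets in a universe\<close>

text \<open>Elementary equivalence does not transport a particular object: the \<open>Z\<close>
  found in \<open>C\<close> is only known to satisfy the sentence, and already among Abelian groups
  \<int> \<oplus> \<int> would be another witness. So the sentence must contain everything that the
  embedding uses, and the sum on Hom(Z, A) must be described by composition alone: x + y is the
  copairing of x and y composed with some morphism d, the stand-in for the diagonal. Smallness of
  \<open>C\<close> then places the groups in the universe, since Hom(Z, A) is a subset of the set of
  morphisms of \<open>C\<close>. A second difficulty comes from the coding: group records that agree
  on their carrier share a code, so an object does not determine a record. Whenever two morphisms
  meet at an object, one of them has to be rewritten over the records of the other.\<close>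

lemma vset_elts [simp]: "vset (elts x) = x"
  unfolding vset_def by (rule the_equality) (auto intro: elts_inject)

lemma elts_vset: "elts v = X \<Longrightarrow> elts (vset X) = X"
  by auto

lemma elts_vset_pair [simp]: "elts (vset {a, b}) = {a, b}"
  using pairing elts_vset by metis

lemma elts_vset_singleton [simp]: "elts (vset {a}) = {a}"
  using elts_vset_pair[of a a] by simp

lemma vpair_inject [simp]: "vpair a b = vpair c d \<longleftrightarrow> a = c \<and> b = d"
proof
  assume "vpair a b = vpair c d"
  then have "elts (vpair a b) = elts (vpair c d)" by simp
  then have eq: "{vset {a}, vset {a, b}} = {vset {c}, vset {c, d}}"
    by (simp add: vpair_def)
  then have "elts ` {vset {a}, vset {a, b}} = elts ` {vset {c}, vset {c, d}}" by simp
  then have "{{a}, {a, b}} = {{c}, {c, d}}" by simp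
  then show "a = c \<and> b = d" by (auto simp: doubleton_eq_iff)
qed simp

lemma vfst_vpair [simp]: "vfst (vpair a b) = a"
  unfolding vfst_def by auto

lemma vsnd_vpair [simp]: "vsnd (vpair a b) = b"
  unfolding vsnd_def by auto

locale universe =
  fixes U :: "'v::sets set"
  assumes universe: "grothendieck_universe U"
begin

text \<open>Closure properties are phrased for HOL sets, so that groups and graphs can be built by
  ordinary set comprehension; \<open>vset\<close> then turns the result into an element of
  \<open>U\<close>.\<close>

definition usmall :: "'v set \<Rightarrow> bool" where
  "usmall X \<longleftrightarrow> (\<exists>x\<in>U. elts x = X)"

lemma usmall_vset:
  assumes "usmall X"
  shows vset_in_U: "vset X \<in> U" and elts_vset_usmall: "elts (vset X) = X"
  using assms unfolding usmall_def by auto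

lemma usmall_elts: "x \<in> U \<Longrightarrow> usmall (elts x)"
  unfolding usmall_def by blast

lemma
  shows universe_trans: "x \<in> U \<Longrightarrow> elts x \<subseteq> U"
    and universe_Pow: "x \<in> U \<Longrightarrow> \<exists>p\<in>U. elts ` elts p = Pow (elts x)"
    and universe_UN: "I \<in> U \<Longrightarrow> (\<And>i. i \<in> elts I \<Longrightarrow> X i \<in> U) \<Longrightarrow>
      \<exists>u\<in>U. elts u = (\<Union>i\<in>elts I. elts (X i))"
    and universe_omega: "\<exists>w\<in>U. is_omega w"
  using universe[unfolded grothendieck_universe_def is_Pow_def] by simp_all

lemma usmall_subset_U: "usmall X \<Longrightarrow> X \<subseteq> U"
  unfolding usmall_def using universe_trans by blast

text \<open>The power set in \<open>U\<close> realizes every HOL subset of \<open>X\<close>,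
  definable or not, and \<open>U\<close> is transitive.\<close>

lemma usmall_subset:
  assumes "usmall X" "Y \<subseteq> X" shows "usmall Y"
proof -
  obtain x where x: "x \<in> U" "elts x = X" using assms unfolding usmall_def by blast
  then obtain p where p: "p \<in> U" "elts ` elts p = Pow X"
    using universe_Pow by metis
  then have "Y \<in> elts ` elts p" using assms by simp
  then obtain y where "y \<in> elts p" "elts y = Y" by auto
  moreover have "elts p \<subseteq> U" using usmall_subset_U usmall_elts p by blast
  ultimately show ?thesis unfolding usmall_def by blast
qed

lemma usmall_UN:
  assumes "usmall I" "\<And>i. i \<in> I \<Longrightarrow> usmall (X i)"
  shows "usmall (\<Union>i\<in>I. X i)"
proof -
  obtain v where v: "v \<in> U" "elts v = I" using assms unfolding usmall_def by blast
  have "\<exists>u\<in>U. elts u = (\<Union>i\<in>elts v. elts (vset (X i)))"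
    using assms v vset_in_U by (intro universe_UN) simp_all
  moreover have "(\<Union>i\<in>elts v. elts (vset (X i))) = (\<Union>i\<in>I. X i)"
    using assms v elts_vset_usmall by simp
  ultimately show ?thesis unfolding usmall_def by simp
qed

text \<open>\<open>a\<close> is a member of its own power set, so \<open>{a}\<close> is a subset of
  a small set.\<close>

lemma usmall_singleton:
  assumes "a \<in> U" shows "usmall {a}"
proof -
  obtain p where p: "p \<in> U" "elts ` elts p = Pow (elts a)"
    using universe_Pow assms by blast
  then have "elts a \<in> elts ` elts p" by simp
  then have "a \<in> elts p" using elts_inject by blast
  then show ?thesis using usmall_subset[OF usmall_elts[OF p(1)]] by simp
qed

text \<open>Replacement: the image is the union of the singletons \<open>{f x}\<close> indexed by
  \<open>X\<close>.\<close>

lemma usmall_image: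
  assumes "usmall X" "f ` X \<subseteq> U" shows "usmall (f ` X)"
  using usmall_UN[OF assms(1), of "\<lambda>x. {f x}"] usmall_singleton assms(2)
  by (simp add: UNION_singleton_eq_range image_subset_iff)

text \<open>The von Neumann numerals are pairwise distinct: m < n makes \<open>num m\<close> a
  member of \<open>num n\<close>, and well-foundedness excludes a set that is a member of
  itself.\<close>

lemma usmall_countably_infinite:
  obtains num :: "nat \<Rightarrow> 'v" where "inj num" "usmall (range num)"
proof -
  obtain w num where w: "w \<in> U" and num: "\<And>k. elts (num (Suc k)) = insert (num k) (elts (num k))"
    and ran: "elts w = range (num :: nat \<Rightarrow> 'v)"
    using universe_omega unfolding is_omega_def by blast
  have mem: "num m \<in> elts (num n)" if "m < n" for m n
    using that by (induction n) (auto simp: num less_Suc_eq)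
  have "x \<notin> elts x" for x :: 'v
    using wf_not_sym[OF wf_elts] by blast
  then have "num m \<noteq> num n" if "m < n" for m n
    using mem[OF that] by metis
  then have "inj num" by (metis injI linorder_neqE_nat)
  then show thesis using that w ran unfolding usmall_def by metis
qed

text \<open>The class axiom \<open>pairing\<close> yields an ambient pair, but not one in
  \<open>U\<close>. That comes from replacement, by collapsing the infinite set of numerals onto
  \<open>{a, b}\<close>.\<close>

lemma usmall_pair:
  assumes "a \<in> U" "b \<in> U" shows "usmall {a, b}"
proof -
  obtain num :: "nat \<Rightarrow> 'v" where num: "inj num" "usmall (range num)"
    by (rule usmall_countably_infinite)
  define f where "f = (\<lambda>x. if x = num 0 then a else b)"
  have "f (num 0) = a" "f (num 1) = b" using num(1) by (auto simp: f_def dest: injD)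
  then have "a \<in> f ` range num" "b \<in> f ` range num" by blast+
  moreover have "f ` range num \<subseteq> {a, b}" by (auto simp: f_def)
  ultimately have "f ` range num = {a, b}" by blast
  then show ?thesis using usmall_image[OF num(2), of f] assms by simp
qed

lemma vpair_in_U [intro]:
  assumes "a \<in> U" "b \<in> U" shows "vpair a b \<in> U"
  unfolding vpair_def using assms usmall_pair[of a a] usmall_pair
  by (simp add: vset_in_U)

lemma usmall_Collect_vpair:
  assumes "usmall X" "f ` X \<subseteq> U"
  shows "usmall {vpair x (f x) |x. x \<in> X}"
proof -
  have "{vpair x (f x) |x. x \<in> X} = (\<lambda>x. vpair x (f x)) ` X" by blast
  moreover have "(\<lambda>x. vpair x (f x)) ` X \<subseteq> U" using assms usmall_subset_U by auto
  ultimately show ?thesis using usmall_image[OF assms(1)] by simp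
qed

lemma usmall_Times:
  assumes "usmall X" "usmall Y"
  shows "usmall {vpair x y |x y. x \<in> X \<and> y \<in> Y}"
proof -
  have "{vpair x y |x y. x \<in> X \<and> y \<in> Y} = (\<Union>x\<in>X. vpair x ` Y)" by blast
  moreover have "usmall (vpair x ` Y)" if "x \<in> X" for x
    using that assms usmall_subset_U by (intro usmall_image) auto
  ultimately show ?thesis using usmall_UN[OF assms(1), of "\<lambda>x. vpair x ` Y"] by simp
qed

section \<open>The category of Abelian groups\<close>

lemma ab_groupsD:
  assumes "G \<in> ab_groups U"
  shows "comm_group G" "usmall (carrier G)"
  using assms unfolding ab_groups_def usmall_def by auto

lemma usmall_mult_graph:
  assumes "G \<in> ab_groups U"
  shows "usmall {vpair (vpair x y) (x \<otimes>\<^bsub>G\<^esub> y) |x y. x \<in> carrier G \<and> y \<in> carrier G}" (is "usmall ?M")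
proof -
  interpret comm_group G using assms by (rule ab_groupsD)
  note C = ab_groupsD(2)[OF assms]
  \<comment> \<open>The graph of the binary operation is read as the graph of a unary function on
    coded pairs.\<close>
  let ?P = "{vpair x y |x y. x \<in> carrier G \<and> y \<in> carrier G}"
  let ?f = "\<lambda>p. vfst p \<otimes>\<^bsub>G\<^esub> vsnd p"
  have "?M = {vpair p (?f p) |p. p \<in> ?P}" by force
  moreover have "usmall \<dots>"
    using C usmall_subset_U[OF C] by (intro usmall_Collect_vpair usmall_Times) auto
  ultimately show ?thesis by simp
qed

lemma usmall_inv_graph:
  assumes "G \<in> ab_groups U"
  shows "usmall {vpair x (inv\<^bsub>G\<^esub> x) |x. x \<in> carrier G}"
proof -
  interpret comm_group G using assms by (rule ab_groupsD)
  note C = ab_groupsD(2)[OF assms]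
  show ?thesis using C usmall_subset_U[OF C] by (intro usmall_Collect_vpair) auto
qed

lemma usmall_hom_graph:
  assumes "G \<in> ab_groups U" "H \<in> ab_groups U" "f \<in> hom G H"
  shows "usmall {vpair x (f x) |x. x \<in> carrier G}"
  using usmall_subset_U[OF ab_groupsD(2)[OF assms(2)]] assms(3)
  by (intro usmall_Collect_vpair ab_groupsD assms) (auto simp: hom_def)

lemma code_group_in_U:
  assumes "G \<in> ab_groups U" shows "code_group G \<in> U"
proof -
  interpret comm_group G using assms by (rule ab_groupsD)
  have "\<one>\<^bsub>G\<^esub> \<in> U" using usmall_subset_U[OF ab_groupsD(2)[OF assms]] by auto
  then show ?thesis unfolding code_group_def
    using assms by (intro vpair_in_U vset_in_U usmall_mult_graph usmall_inv_graph ab_groupsD)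
qed

lemma elts_vfst_code_group [simp]:
  "G \<in> ab_groups U \<Longrightarrow> elts (vfst (code_group G)) = carrier G"
  by (simp add: code_group_def elts_vset_usmall ab_groupsD)

lemma code_group_eqD:
  assumes "G \<in> ab_groups U" "H \<in> ab_groups U" "code_group G = code_group H"
  shows "carrier G = carrier H" "\<one>\<^bsub>G\<^esub> = \<one>\<^bsub>H\<^esub>"
    "\<And>x y. x \<in> carrier G \<Longrightarrow> y \<in> carrier G \<Longrightarrow> x \<otimes>\<^bsub>G\<^esub> y = x \<otimes>\<^bsub>H\<^esub> y"
proof -
  show "carrier G = carrier H" using assms by (metis elts_vfst_code_group)
  show "\<one>\<^bsub>G\<^esub> = \<one>\<^bsub>H\<^esub>" using assms(3) by (simp add: code_group_def)
  fix x y assume xy: "x \<in> carrier G" "y \<in> carrier G"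
  have "elts (vset {vpair (vpair x y) (x \<otimes>\<^bsub>G\<^esub> y) |x y. x \<in> carrier G \<and> y \<in> carrier G})
      = elts (vset {vpair (vpair x y) (x \<otimes>\<^bsub>H\<^esub> y) |x y. x \<in> carrier H \<and> y \<in> carrier H})"
    using assms(3) by (simp add: code_group_def)
  then have "{vpair (vpair x y) (x \<otimes>\<^bsub>G\<^esub> y) |x y. x \<in> carrier G \<and> y \<in> carrier G}
      = {vpair (vpair x y) (x \<otimes>\<^bsub>H\<^esub> y) |x y. x \<in> carrier H \<and> y \<in> carrier H}"
    by (simp only: elts_vset_usmall[OF usmall_mult_graph[OF assms(1)]]
        elts_vset_usmall[OF usmall_mult_graph[OF assms(2)]])
  moreover have "vpair (vpair x y) (x \<otimes>\<^bsub>G\<^esub> y)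
      \<in> {vpair (vpair x y) (x \<otimes>\<^bsub>G\<^esub> y) |x y. x \<in> carrier G \<and> y \<in> carrier G}"
    using xy by blast
  ultimately show "x \<otimes>\<^bsub>G\<^esub> y = x \<otimes>\<^bsub>H\<^esub> y" by auto
qed

text \<open>Equal codes do not give equal records, but being a homomorphism depends only on the
  carriers and on the products inside them, which the codes determine.\<close>

lemma code_group_eq_hom:
  assumes "G \<in> ab_groups U" "G' \<in> ab_groups U" "code_group G = code_group G'"
    and "H \<in> ab_groups U" "H' \<in> ab_groups U" "code_group H = code_group H'"
  shows "hom G H = hom G' H'"
  using code_group_eqD[OF assms(1-3)] code_group_eqD[OF assms(4-6)]
  unfolding hom_def by (auto simp: Pi_iff)

lemma source_code_hom [simp]: "source (code_hom G H f) = code_group G"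
  and target_code_hom [simp]: "target (code_hom G H f) = code_group H"
  by (simp_all add: code_hom_def source_def target_def)

lemma elts_graph_code_hom:
  assumes "G \<in> ab_groups U" "H \<in> ab_groups U" "f \<in> hom G H"
  shows "elts (graph (code_hom G H f)) = {vpair x (f x) |x. x \<in> carrier G}"
  using elts_vset_usmall[OF usmall_hom_graph[OF assms]] by (simp add: code_hom_def graph_def)

lemma code_hom_cong:
  assumes "code_group G = code_group G'" "code_group H = code_group H'"
    and "carrier G = carrier G'" "\<And>x. x \<in> carrier G \<Longrightarrow> f x = f' x"
  shows "code_hom G H f = code_hom G' H' f'"
proof -
  have "{vpair x (f x) |x. x \<in> carrier G} = {vpair x (f' x) |x. x \<in> carrier G'}"
    using assms by force
  then show ?thesis using assms by (simp add: code_hom_def)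
qed

text \<open>A code contains \<open>vset\<close> of a graph, from which the graph is recovered only
  if some set has it as extension; the membership hypotheses ensure this on both sides.\<close>

lemma code_hom_eqD:
  assumes "code_hom G H f = code_hom G' H' f'" "x \<in> carrier G"
    and "G \<in> ab_groups U" "H \<in> ab_groups U" "f \<in> hom G H"
    and "G' \<in> ab_groups U" "H' \<in> ab_groups U" "f' \<in> hom G' H'"
  shows "f x = f' x"
proof -
  have "{vpair x (f x) |x. x \<in> carrier G} = {vpair x (f' x) |x. x \<in> carrier G'}"
    using arg_cong[OF assms(1), of "\<lambda>m. elts (graph m)"]
    by (simp only: elts_graph_code_hom[OF assms(3-5)] elts_graph_code_hom[OF assms(6-8)])
  moreover have "vpair x (f x) \<in> {vpair x (f x) |x. x \<in> carrier G}" using assms(2) by blast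
  ultimately show ?thesis by auto
qed

lemma hom_codesI:
  "G \<in> ab_groups U \<Longrightarrow> H \<in> ab_groups U \<Longrightarrow> f \<in> hom G H \<Longrightarrow> code_hom G H f \<in> hom_codes U"
  unfolding hom_codes_def by blast

lemma hom_codesE:
  assumes "m \<in> hom_codes U"
  obtains G H f where "G \<in> ab_groups U" "H \<in> ab_groups U" "f \<in> hom G H" "m = code_hom G H f"
  using assms unfolding hom_codes_def by blast

text \<open>Change of representatives: a morphism whose ends are known only as codes is rewritten
  over prescribed records \<open>G\<close> and \<open>H\<close>. This is how two composable
  morphisms are put over a common middle group.\<close>

lemma hom_codes_betweenE:
  assumes "m \<in> hom_codes U" "source m = code_group G" "target m = code_group H"
    and G: "G \<in> ab_groups U" and H: "H \<in> ab_groups U"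
  obtains f where "f \<in> hom G H" "m = code_hom G H f"
proof -
  obtain G' H' f where f: "G' \<in> ab_groups U" "H' \<in> ab_groups U" "f \<in> hom G' H'" "m = code_hom G' H' f"
    using assms(1) by (rule hom_codesE)
  then have eq: "code_group G' = code_group G" "code_group H' = code_group H" using assms by auto
  have "f \<in> hom G H" using code_group_eq_hom[OF f(1) G eq(1) f(2) H eq(2)] f by simp
  moreover have "m = code_hom G H f"
    unfolding f(4) using eq code_group_eqD(1)[OF f(1) G eq(1)] by (intro code_hom_cong) auto
  ultimately show thesis by (rule that)
qed

lemma code_hom_in_U:
  assumes "G \<in> ab_groups U" "H \<in> ab_groups U" "f \<in> hom G H"
  shows "code_hom G H f \<in> U"
  unfolding code_hom_def using assms
  by (intro vpair_in_U code_group_in_U vset_in_U usmall_hom_graph)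

section \<open>Composition and the category axioms\<close>

lemma Ab_simps [simp]:
  "Obj (Ab U) = code_group ` ab_groups U" "Mor (Ab U) = hom_codes U"
  "Dom (Ab U) = source" "Rng (Ab U) = target"
  by (simp_all add: Ab_def)

lemma Idm_Ab:
  "G \<in> ab_groups U \<Longrightarrow> Idm (Ab U) (code_group G) = code_hom G G (\<lambda>x. x)"
  by (simp add: Ab_def code_hom_def)

lemma id_hom: "(\<lambda>x. x) \<in> hom G G"
  by (simp add: hom_def)

lemma Cmp_Ab:
  assumes "G \<in> ab_groups U" "H \<in> ab_groups U" "K \<in> ab_groups U" "f \<in> hom G H" "g \<in> hom H K"
  shows "Cmp (Ab U) (code_hom H K g) (code_hom G H f) = Some (code_hom G K (\<lambda>x. g (f x)))"
proof -
  \<comment> \<open>The relational composite is the graph of the composed function because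
    \<open>f\<close> maps into the carrier of \<open>H\<close>, where the graph of \<open>g\<close>
    is defined.\<close>
  have "{vpair x z |x z. \<exists>y. vpair x y \<in> elts (graph (code_hom G H f)) \<and>
      vpair y z \<in> elts (graph (code_hom H K g))} = {vpair x (g (f x)) |x. x \<in> carrier G}"
    unfolding elts_graph_code_hom[OF assms(1,2,4)] elts_graph_code_hom[OF assms(2,3,5)]
    using assms(4) by (auto simp: hom_def)
  then show ?thesis using assms
    by (simp add: Ab_def hom_codesI) (simp add: code_hom_def)
qed

lemma Cmp_AbD:
  assumes "Cmp (Ab U) g f = Some h"
  shows "g \<in> hom_codes U" "f \<in> hom_codes U" "source g = target f"
  using assms by (auto simp: Ab_def split: if_splits)

lemma hom_compose_fun: "f \<in> hom G H \<Longrightarrow> g \<in> hom H K \<Longrightarrow> (\<lambda>x. g (f x)) \<in> hom G K"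
  by (auto simp: hom_def Pi_iff)

lemma Cmp_AbE:
  assumes "Cmp (Ab U) g f = Some h"
  obtains G H K p q where "G \<in> ab_groups U" "H \<in> ab_groups U" "K \<in> ab_groups U"
    "p \<in> hom G H" "q \<in> hom H K" "f = code_hom G H p" "g = code_hom H K q"
    "h = code_hom G K (\<lambda>x. q (p x))"
proof -
  note fg = Cmp_AbD[OF assms]
  obtain G H p where f: "G \<in> ab_groups U" "H \<in> ab_groups U" "p \<in> hom G H" "f = code_hom G H p"
    using fg(2) by (rule hom_codesE)
  obtain H' K q' where g: "H' \<in> ab_groups U" "K \<in> ab_groups U" "q' \<in> hom H' K" "g = code_hom H' K q'"
    using fg(1) by (rule hom_codesE)
  obtain q where q: "q \<in> hom H K" "g = code_hom H K q"
    using hom_codes_betweenE[OF fg(1), of H K] fg(3) f g by auto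
  have "h = code_hom G K (\<lambda>x. q (p x))"
    using assms unfolding f(4) q(2) Cmp_Ab[OF f(1,2) g(2) f(3) q(1)] by simp
  then show thesis using that[of G H K p q] f g(2) q by blast
qed

lemma lcat_structure_Ab: "lcat_structure (Ab U)"
  unfolding lcat_structure_def
proof (intro conjI allI impI)
  show "Dom (Ab U) \<in> Mor (Ab U) \<rightarrow> Obj (Ab U)" "Rng (Ab U) \<in> Mor (Ab U) \<rightarrow> Obj (Ab U)"
    by (auto elim!: hom_codesE)
  show "Idm (Ab U) \<in> Obj (Ab U) \<rightarrow> Mor (Ab U)"
    by (auto simp: Idm_Ab intro: hom_codesI[OF _ _ id_hom])
  fix g f h assume "Cmp (Ab U) g f = Some h"
  then show "g \<in> Mor (Ab U)" "f \<in> Mor (Ab U)" "h \<in> Mor (Ab U)"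
    by (rule Cmp_AbE; simp add: hom_codesI hom_compose_fun)+
qed

lemma category_Ab: "category (Ab U)"
  unfolding category_def
proof (intro conjI allI ballI impI lcat_structure_Ab)
  fix g f assume gf: "g \<in> Mor (Ab U)" "f \<in> Mor (Ab U)"
  show "Cmp (Ab U) g f \<noteq> None \<longleftrightarrow> Dom (Ab U) g = Rng (Ab U) f"
    using gf by (auto simp: Ab_def)
next
  fix g f h assume "Cmp (Ab U) g f = Some h"
  then show "Dom (Ab U) h = Dom (Ab U) f" "Rng (Ab U) h = Rng (Ab U) g"
    by (auto elim!: Cmp_AbE)
next
  fix x assume "x \<in> Obj (Ab U)"
  then show "Dom (Ab U) (Idm (Ab U) x) = x" "Rng (Ab U) (Idm (Ab U) x) = x"
    by (auto simp: Idm_Ab)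
next
  fix f assume "f \<in> Mor (Ab U)"
  then obtain G H p where p: "G \<in> ab_groups U" "H \<in> ab_groups U" "p \<in> hom G H" "f = code_hom G H p"
    by (auto elim: hom_codesE)
  then show "Cmp (Ab U) f (Idm (Ab U) (Dom (Ab U) f)) = Some f"
    "Cmp (Ab U) (Idm (Ab U) (Rng (Ab U) f)) f = Some f"
    by (simp_all add: Idm_Ab Cmp_Ab id_hom)
next
  fix h g f hg gf assume *: "Cmp (Ab U) h g = Some hg \<and> Cmp (Ab U) g f = Some gf"
  then have fgh: "h \<in> hom_codes U" "g \<in> hom_codes U" "f \<in> hom_codes U"
      "source h = target g" "source g = target f"
    by (blast dest: Cmp_AbD)+
  obtain A B p where p: "A \<in> ab_groups U" "B \<in> ab_groups U" "p \<in> hom A B" "f = code_hom A B p"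
    using fgh(3) by (rule hom_codesE)
  obtain C D r where r: "C \<in> ab_groups U" "D \<in> ab_groups U" "r \<in> hom C D" "h = code_hom C D r"
    using fgh(1) by (rule hom_codesE)
  obtain q where q: "q \<in> hom B C" "g = code_hom B C q"
    using hom_codes_betweenE[OF fgh(2), of B C] fgh p r by auto
  have "hg = code_hom B D (\<lambda>x. r (q x))" "gf = code_hom A C (\<lambda>x. q (p x))"
    using * p q r by (auto simp: Cmp_Ab)
  then show "Cmp (Ab U) hg f = Cmp (Ab U) h gf"
    using p q r by (simp add: Cmp_Ab hom_compose_fun)
qed

end

lemma categoryD:
  "category S \<Longrightarrow> lcat_structure S"
  "category S \<Longrightarrow> \<forall>g\<in>Mor S. \<forall>f\<in>Mor S. Cmp S g f \<noteq> None \<longleftrightarrow> Dom S g = Rng S f"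
  "category S \<Longrightarrow> \<forall>g f h. Cmp S g f = Some h \<longrightarrow> Dom S h = Dom S f \<and> Rng S h = Rng S g"
  "category S \<Longrightarrow> \<forall>x\<in>Obj S. Dom S (Idm S x) = x \<and> Rng S (Idm S x) = x"
  "category S \<Longrightarrow>
     \<forall>f\<in>Mor S. Cmp S f (Idm S (Dom S f)) = Some f \<and> Cmp S (Idm S (Rng S f)) f = Some f"
  "category S \<Longrightarrow>
     \<forall>h g f hg gf. Cmp S h g = Some hg \<and> Cmp S g f = Some gf \<longrightarrow> Cmp S hg f = Cmp S h gf"
  by (unfold category_def, (elim conjE, assumption)+)

section \<open>A first-order sentence\<close>

definition Imp :: "fm \<Rightarrow> fm \<Rightarrow> fm" where
  "Imp p q = Neg (Conj p (Neg q))"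

definition Iff :: "fm \<Rightarrow> fm \<Rightarrow> fm" where
  "Iff p q = Conj (Imp p q) (Imp q p)"

definition ExM :: "nat \<Rightarrow> fm \<Rightarrow> fm" where
  "ExM n p = Neg (AllM n (Neg p))"

lemma sat_connectives [simp]:
  "sat S a b (Imp p q) \<longleftrightarrow> (sat S a b p \<longrightarrow> sat S a b q)"
  "sat S a b (Iff p q) \<longleftrightarrow> (sat S a b p \<longleftrightarrow> sat S a b q)"
  "sat S a b (ExM n p) \<longleftrightarrow> (\<exists>f\<in>Mor S. sat S a (b(n := f)) p)"
  by (auto simp: Imp_def Iff_def ExM_def)

lemma free_vars_connectives [simp]:
  "free_ovars (Imp p q) = free_ovars p \<union> free_ovars q"
  "free_mvars (Imp p q) = free_mvars p \<union> free_mvars q"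
  "free_ovars (Iff p q) = free_ovars p \<union> free_ovars q"
  "free_mvars (Iff p q) = free_mvars p \<union> free_mvars q"
  "free_ovars (ExM n p) = free_ovars p"
  "free_mvars (ExM n p) = free_mvars p - {n}"
  by (auto simp: Imp_def Iff_def ExM_def)

abbreviation CmpV :: "nat \<Rightarrow> nat \<Rightarrow> nat \<Rightarrow> fm" where
  "CmpV k l n \<equiv> FCmp (MVar k) (MVar l) (MVar n)"

abbreviation DomEq :: "nat \<Rightarrow> nat \<Rightarrow> fm" where
  "DomEq k l \<equiv> EqO (TDom (MVar k)) (TDom (MVar l))"

abbreviation RngEq :: "nat \<Rightarrow> nat \<Rightarrow> fm" where
  "RngEq k l \<equiv> EqO (TRng (MVar k)) (TRng (MVar l))"

text \<open>In the associativity clause the morphism variables 0 to 5 stand for h, g, f, hg, gf and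
  an arbitrary value. Equality of two possibly undefined composites is not atomic, so it is
  expressed by having the same values.\<close>

definition category_fm :: fm where
  "category_fm =
     Conj (AllM 0 (AllM 1 (Iff (ExM 2 (CmpV 0 1 2)) (EqO (TDom (MVar 0)) (TRng (MVar 1))))))
    (Conj (AllM 0 (AllM 1 (AllM 2 (Imp (CmpV 0 1 2) (Conj (DomEq 2 1) (RngEq 2 0))))))
    (Conj (AllO 0 (Conj (EqO (TDom (TId (OVar 0))) (OVar 0)) (EqO (TRng (TId (OVar 0))) (OVar 0))))
    (Conj (AllM 0 (Conj (FCmp (MVar 0) (TId (TDom (MVar 0))) (MVar 0))
                        (FCmp (TId (TRng (MVar 0))) (MVar 0) (MVar 0))))
          (AllM 0 (AllM 1 (AllM 2 (AllM 3 (AllM 4 (AllM 5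
             (Imp (Conj (CmpV 0 1 3) (CmpV 1 2 4)) (Iff (CmpV 3 2 5) (CmpV 0 4 5))))))))))))"

lemma sat_category_fm:
  assumes S: "lcat_structure S"
  shows "sat S a b category_fm \<longleftrightarrow> category S"
proof -
  have M: "g \<in> Mor S" "f \<in> Mor S" "h \<in> Mor S" if "Cmp S g f = Some h" for g f h
    using S that unfolding lcat_structure_def by blast+
  \<comment> \<open>The formula quantifies over \<open>Mor S\<close>, whereas
    \<open>category\<close> quantifies over the whole type and compares options. The two agree
    because arguments and values of a defined composition lie in \<open>Mor S\<close>.\<close>
  have 1: "Cmp S g f \<noteq> None \<longleftrightarrow> (\<exists>h\<in>Mor S. Cmp S g f = Some h)" for g f
    using M by auto
  have 2: "Cmp S g f = Cmp S g' f' \<longleftrightarrow>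
      (\<forall>h\<in>Mor S. Cmp S g f = Some h \<longleftrightarrow> Cmp S g' f' = Some h)" for g f g' f'
    using M by (cases "Cmp S g f"; cases "Cmp S g' f'") auto
  have 3: "(\<forall>g f h. Cmp S g f = Some h \<longrightarrow> P g f h) \<longleftrightarrow>
      (\<forall>g\<in>Mor S. \<forall>f\<in>Mor S. \<forall>h\<in>Mor S. Cmp S g f = Some h \<longrightarrow> P g f h)" for P
    using M by blast
  have 4: "(\<forall>h g f hg gf. Cmp S h g = Some hg \<and> Cmp S g f = Some gf \<longrightarrow> Cmp S hg f = Cmp S h gf) \<longleftrightarrow>
      (\<forall>h\<in>Mor S. \<forall>g\<in>Mor S. \<forall>f\<in>Mor S. \<forall>hg\<in>Mor S. \<forall>gf\<in>Mor S. \<forall>k\<in>Mor S.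
        Cmp S h g = Some hg \<and> Cmp S g f = Some gf \<longrightarrow>
        (Cmp S hg f = Some k \<longleftrightarrow> Cmp S h gf = Some k))"
    unfolding 2 using M by blast
  have "sat S a b category_fm \<longleftrightarrow>
     (\<forall>g\<in>Mor S. \<forall>f\<in>Mor S. (\<exists>h\<in>Mor S. Cmp S g f = Some h) \<longleftrightarrow> Dom S g = Rng S f) \<and>
     (\<forall>g\<in>Mor S. \<forall>f\<in>Mor S. \<forall>h\<in>Mor S. Cmp S g f = Some h \<longrightarrow>
        Dom S h = Dom S f \<and> Rng S h = Rng S g) \<and>
     (\<forall>x\<in>Obj S. Dom S (Idm S x) = x \<and> Rng S (Idm S x) = x) \<and>
     (\<forall>f\<in>Mor S. Cmp S f (Idm S (Dom S f)) = Some f \<and> Cmp S (Idm S (Rng S f)) f = Some f) \<and>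
     (\<forall>h\<in>Mor S. \<forall>g\<in>Mor S. \<forall>f\<in>Mor S. \<forall>hg\<in>Mor S. \<forall>gf\<in>Mor S. \<forall>k\<in>Mor S.
        Cmp S h g = Some hg \<and> Cmp S g f = Some gf \<longrightarrow>
        (Cmp S hg f = Some k \<longleftrightarrow> Cmp S h gf = Some k))"
    by (simp add: category_fm_def)
  also have "\<dots> \<longleftrightarrow> category S"
    unfolding category_def 1 3 4 using S by simp
  finally show ?thesis .
qed

text \<open>
  For a category with a coproduct \<open>W\<close> of two copies of \<open>Z\<close>, with coprojections \<open>i\<close> and \<open>j\<close>, a
  morphism \<open>d : Z \<rightarrow> W\<close> induces a binary operation on the morphisms from \<open>Z\<close> to any fixed object.
  It sends \<open>x\<close> and \<open>y\<close> to the composite of the copairing of \<open>x\<close> and \<open>y\<close> after \<open>d\<close>.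
\<close>

definition cogroup_add :: "('o, 'm) lcat \<Rightarrow> 'm \<Rightarrow> 'm \<Rightarrow> 'm \<Rightarrow> 'm \<Rightarrow> 'm \<Rightarrow> 'm \<Rightarrow> bool" where
  "cogroup_add S i j d x y z \<longleftrightarrow>
     (\<exists>m\<in>Mor S. Cmp S m i = Some x \<and> Cmp S m j = Some y \<and> Cmp S m d = Some z)"

text \<open>The group laws are imposed on points, that is, on morphisms out of \<open>Z\<close>,
  instead of on morphisms into iterated coproducts, so a single coproduct \<open>W\<close> is
  enough. Neutral elements and inverses are asked for separately over each object \<open>A\<close>;
  that postcomposition respects the sum is a consequence of the copairing description and need not
  be imposed.\<close>

definition separating_cogroup :: "('o, 'm) lcat \<Rightarrow> 'm \<Rightarrow> 'm \<Rightarrow> 'm \<Rightarrow> bool" where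
  "separating_cogroup S i j d \<longleftrightarrow>
     Dom S j = Dom S i \<and> Dom S d = Dom S i \<and> Rng S j = Rng S i \<and> Rng S d = Rng S i \<and>
     (\<forall>x\<in>Mor S. \<forall>y\<in>Mor S. Dom S x = Dom S i \<longrightarrow> Dom S y = Dom S i \<longrightarrow> Rng S x = Rng S y \<longrightarrow>
        (\<exists>m\<in>Mor S. Cmp S m i = Some x \<and> Cmp S m j = Some y)) \<and>
     (\<forall>m\<in>Mor S. \<forall>n\<in>Mor S. \<forall>x\<in>Mor S. \<forall>y\<in>Mor S.
        Cmp S m i = Some x \<longrightarrow> Cmp S m j = Some y \<longrightarrow>
        Cmp S n i = Some x \<longrightarrow> Cmp S n j = Some y \<longrightarrow> m = n) \<and>
     (\<forall>x\<in>Mor S. \<forall>y\<in>Mor S. \<forall>z\<in>Mor S. \<forall>u\<in>Mor S. \<forall>v\<in>Mor S. \<forall>w\<in>Mor S.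
        cogroup_add S i j d x y u \<longrightarrow> cogroup_add S i j d u z w \<longrightarrow>
        cogroup_add S i j d y z v \<longrightarrow> cogroup_add S i j d x v w) \<and>
     (\<forall>x\<in>Mor S. \<forall>y\<in>Mor S. \<forall>z\<in>Mor S. cogroup_add S i j d x y z \<longrightarrow> cogroup_add S i j d y x z) \<and>
     (\<forall>A\<in>Obj S. \<exists>e\<in>Mor S. Dom S e = Dom S i \<and> Rng S e = A \<and>
        (\<forall>x\<in>Mor S. Dom S x = Dom S i \<longrightarrow> Rng S x = A \<longrightarrow>
           cogroup_add S i j d e x x \<and> (\<exists>y\<in>Mor S. cogroup_add S i j d y x e))) \<and>
     (\<forall>f\<in>Mor S. \<forall>g\<in>Mor S. Dom S f = Dom S g \<longrightarrow> Rng S f = Rng S g \<longrightarrow>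
        (\<forall>x\<in>Mor S. \<forall>u\<in>Mor S. Dom S x = Dom S i \<longrightarrow> Cmp S f x = Some u \<longrightarrow> Cmp S g x = Some u) \<longrightarrow>
        f = g)"

text \<open>Variables 0, 1, 2 are reserved for \<open>i\<close>, \<open>j\<close>, \<open>d\<close>,
  and 9 for the bound copairing, so the three arguments must differ from 9.\<close>

definition add_fm :: "nat \<Rightarrow> nat \<Rightarrow> nat \<Rightarrow> fm" where
  "add_fm x y z = ExM 9 (Conj (CmpV 9 0 x) (Conj (CmpV 9 1 y) (CmpV 9 2 z)))"

lemma sat_add_fm:
  "x \<noteq> 9 \<Longrightarrow> y \<noteq> 9 \<Longrightarrow> z \<noteq> 9 \<Longrightarrow>
   sat S a b (add_fm x y z) \<longleftrightarrow> cogroup_add S (b 0) (b 1) (b 2) (b x) (b y) (b z)"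
  by (auto simp: add_fm_def cogroup_add_def)

lemma free_vars_add_fm [simp]:
  "free_ovars (add_fm x y z) = {}"
  "free_mvars (add_fm x y z) = {0, 1, 2, x, y, z} - {9}"
  by (auto simp: add_fm_def)

text \<open>The morphism variables 0, 1, 2 stay free for \<open>i\<close>, \<open>j\<close>,
  \<open>d\<close>. In the clause on neutral elements the bound object variable 0 belongs to the
  other sort and does not clash with \<open>i\<close>.\<close>

definition separating_cogroup_fm :: fm where
  "separating_cogroup_fm =
    Conj (DomEq 1 0) (Conj (DomEq 2 0) (Conj (RngEq 1 0) (Conj (RngEq 2 0)
   (Conj (AllM 3 (AllM 4 (Imp (DomEq 3 0) (Imp (DomEq 4 0) (Imp (RngEq 3 4)
            (ExM 5 (Conj (CmpV 5 0 3) (CmpV 5 1 4))))))))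
   (Conj (AllM 3 (AllM 4 (AllM 5 (AllM 6
            (Imp (CmpV 3 0 5) (Imp (CmpV 3 1 6) (Imp (CmpV 4 0 5) (Imp (CmpV 4 1 6)
              (EqM (MVar 3) (MVar 4))))))))))
   (Conj (AllM 3 (AllM 4 (AllM 5 (AllM 6 (AllM 7 (AllM 8
            (Imp (add_fm 3 4 6) (Imp (add_fm 6 5 8) (Imp (add_fm 4 5 7) (add_fm 3 7 8))))))))))
   (Conj (AllM 3 (AllM 4 (AllM 5 (Imp (add_fm 3 4 5) (add_fm 4 3 5)))))
   (Conj (AllO 0 (ExM 3 (Conj (DomEq 3 0) (Conj (EqO (TRng (MVar 3)) (OVar 0))
            (AllM 4 (Imp (DomEq 4 0) (Imp (EqO (TRng (MVar 4)) (OVar 0))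
               (Conj (add_fm 3 4 4) (ExM 5 (add_fm 5 4 3))))))))))
         (AllM 3 (AllM 4 (Imp (DomEq 3 4) (Imp (RngEq 3 4) (Imp
            (AllM 5 (AllM 6 (Imp (DomEq 5 0) (Imp (CmpV 3 5 6) (CmpV 4 5 6)))))
            (EqM (MVar 3) (MVar 4)))))))))))))))"

lemma sat_separating_cogroup_fm:
  "sat S a b separating_cogroup_fm \<longleftrightarrow> separating_cogroup S (b 0) (b 1) (b 2)"
  unfolding separating_cogroup_fm_def separating_cogroup_def
  by (simp add: sat_add_fm)

lemma sentence_separating_cogroup:
  "sentence (Conj category_fm (ExM 0 (ExM 1 (ExM 2 separating_cogroup_fm))))"
  by (auto simp: sentence_def category_fm_def separating_cogroup_fm_def)

lemma separating_cogroup_transfer: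
  assumes "lcat_structure C" "elementarily_equivalent C S" "category S"
    and "i \<in> Mor S" "j \<in> Mor S" "d \<in> Mor S" "separating_cogroup S i j d"
  shows "category C" "\<exists>i\<in>Mor C. \<exists>j\<in>Mor C. \<exists>d\<in>Mor C. separating_cogroup C i j d"
proof -
  let ?p = "Conj category_fm (ExM 0 (ExM 1 (ExM 2 separating_cogroup_fm)))"
  have sat: "sat T a b ?p \<longleftrightarrow> category T \<and> (\<exists>i\<in>Mor T. \<exists>j\<in>Mor T. \<exists>d\<in>Mor T. separating_cogroup T i j d)"
    if "lcat_structure T" for T :: "('x, 'y) lcat" and a b
    using that by (simp add: sat_category_fm sat_separating_cogroup_fm)
  have "lcat_structure S" using assms(3) by (simp add: category_def)
  then have "models S ?p" using assms sat[of S] unfolding models_def by blast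
  then have "models C ?p"
    using assms(2) sentence_separating_cogroup unfolding elementarily_equivalent_def by blast
  then show "category C" "\<exists>i\<in>Mor C. \<exists>j\<in>Mor C. \<exists>d\<in>Mor C. separating_cogroup C i j d"
    using sat[OF assms(1)] unfolding models_def by blast+
qed

section \<open>The functor represented by a separating cogroup\<close>

locale cogroup_category =
  fixes C :: "('o, 'm) lcat" and i j d
  assumes category: "category C"
    and mors: "i \<in> Mor C" "j \<in> Mor C" "d \<in> Mor C"
    and cogroup: "separating_cogroup C i j d"
begin

lemma
  shows lcat: "lcat_structure C"
    and Cmp_None_iff: "g \<in> Mor C \<Longrightarrow> f \<in> Mor C \<Longrightarrow> Cmp C g f \<noteq> None \<longleftrightarrow> Dom C g = Rng C f"
    and Idm_laws: "A \<in> Obj C \<Longrightarrow> Dom C (Idm C A) = A" "A \<in> Obj C \<Longrightarrow> Rng C (Idm C A) = A"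
      "f \<in> Mor C \<Longrightarrow> Cmp C (Idm C (Rng C f)) f = Some f"
  using categoryD(1,2,4,5)[OF category] by blast+

lemma Cmp_Mor:
  assumes "Cmp C g f = Some h"
  shows "g \<in> Mor C" "f \<in> Mor C" "h \<in> Mor C"
  using lcat assms unfolding lcat_structure_def by blast+

lemma Cmp_ends:
  assumes "Cmp C g f = Some h"
  shows "Dom C h = Dom C f" "Rng C h = Rng C g" "Dom C g = Rng C f"
proof -
  show "Dom C h = Dom C f" "Rng C h = Rng C g"
    using categoryD(3)[OF category] assms by blast+
  show "Dom C g = Rng C f"
    using Cmp_None_iff[OF Cmp_Mor(1,2)[OF assms]] assms by simp
qed

lemma Cmp_ex:
  assumes "g \<in> Mor C" "f \<in> Mor C" "Dom C g = Rng C f"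
  obtains h where "Cmp C g f = Some h"
  using Cmp_None_iff[OF assms(1,2)] assms(3) by blast

lemma Cmp_assoc:
  "Cmp C h g = Some hg \<Longrightarrow> Cmp C g f = Some gf \<Longrightarrow> Cmp C hg f = Cmp C h gf"
  using categoryD(6)[OF category] by blast

lemma Rng_Obj: "f \<in> Mor C \<Longrightarrow> Rng C f \<in> Obj C" and Dom_Obj: "f \<in> Mor C \<Longrightarrow> Dom C f \<in> Obj C"
  using lcat unfolding lcat_structure_def by blast+

abbreviation add where "add \<equiv> cogroup_add C i j d"

text \<open>This is Hom(Z, A), where \<open>Z\<close> is the common domain of \<open>i\<close>,
  \<open>j\<close> and \<open>d\<close>.\<close>

definition pts :: "'o \<Rightarrow> 'm set" where
  "pts A = {x \<in> Mor C. Dom C x = Dom C i \<and> Rng C x = A}"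

lemma
  shows ends: "Dom C j = Dom C i" "Dom C d = Dom C i" "Rng C j = Rng C i" "Rng C d = Rng C i"
    and copair_ex: "x \<in> pts A \<Longrightarrow> y \<in> pts A \<Longrightarrow> \<exists>m\<in>Mor C. Cmp C m i = Some x \<and> Cmp C m j = Some y"
  using cogroup unfolding separating_cogroup_def pts_def by simp_all

lemma
  shows copair_unique': "\<forall>m\<in>Mor C. \<forall>n\<in>Mor C. \<forall>x\<in>Mor C. \<forall>y\<in>Mor C.
        Cmp C m i = Some x \<longrightarrow> Cmp C m j = Some y \<longrightarrow>
        Cmp C n i = Some x \<longrightarrow> Cmp C n j = Some y \<longrightarrow> m = n"
    and add_assoc': "\<forall>x\<in>Mor C. \<forall>y\<in>Mor C. \<forall>z\<in>Mor C. \<forall>u\<in>Mor C. \<forall>v\<in>Mor C. \<forall>w\<in>Mor C.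
        add x y u \<longrightarrow> add u z w \<longrightarrow> add y z v \<longrightarrow> add x v w"
    and add_comm': "\<forall>x\<in>Mor C. \<forall>y\<in>Mor C. \<forall>z\<in>Mor C. add x y z \<longrightarrow> add y x z"
    and separating': "\<forall>f\<in>Mor C. \<forall>g\<in>Mor C. Dom C f = Dom C g \<longrightarrow> Rng C f = Rng C g \<longrightarrow>
        (\<forall>x\<in>Mor C. \<forall>u\<in>Mor C. Dom C x = Dom C i \<longrightarrow> Cmp C f x = Some u \<longrightarrow> Cmp C g x = Some u) \<longrightarrow>
        f = g"
  using cogroup unfolding separating_cogroup_def by - (elim conjE, assumption)+

lemma copair_unique:
  assumes "Cmp C m i = Some x" "Cmp C m j = Some y" "Cmp C n i = Some x" "Cmp C n j = Some y"
  shows "m = n"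
  using copair_unique' assms Cmp_Mor[OF assms(1)] Cmp_Mor[OF assms(2)] Cmp_Mor[OF assms(3)] by blast

text \<open>All three are composites of one copairing \<open>m\<close> with parallel morphisms, so
  they are points of the codomain of \<open>m\<close>.\<close>

lemma add_pts:
  assumes "add x y z"
  shows "x \<in> pts (Rng C z)" "y \<in> pts (Rng C z)" "z \<in> pts (Rng C z)"
proof -
  obtain m where m: "Cmp C m i = Some x" "Cmp C m j = Some y" "Cmp C m d = Some z"
    using assms unfolding cogroup_add_def by blast
  then show "x \<in> pts (Rng C z)" "y \<in> pts (Rng C z)" "z \<in> pts (Rng C z)"
    using m[THEN Cmp_Mor(3)] m[THEN Cmp_ends(1)] m[THEN Cmp_ends(2)] ends
    by (simp_all add: pts_def)
qed

lemma add_assoc: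
  assumes "add x y u" "add u z w" "add y z v"
  shows "add x v w"
proof -
  have "x \<in> Mor C" "y \<in> Mor C" "z \<in> Mor C" "u \<in> Mor C" "v \<in> Mor C" "w \<in> Mor C"
    using assms[THEN add_pts(1)] assms[THEN add_pts(2)] assms[THEN add_pts(3)] by (simp_all add: pts_def)
  then show ?thesis using add_assoc' assms by blast
qed

lemma add_comm:
  assumes "add x y z" shows "add y x z"
proof -
  have "x \<in> Mor C" "y \<in> Mor C" "z \<in> Mor C"
    using add_pts[OF assms] by (simp_all add: pts_def)
  then show ?thesis using add_comm' assms by blast
qed

lemma add_zero_ex:
  assumes "A \<in> Obj C"
  shows "\<exists>e\<in>pts A. \<forall>x\<in>pts A. add e x x \<and> (\<exists>y\<in>Mor C. add y x e)"
proof -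
  have "\<forall>A\<in>Obj C. \<exists>e\<in>Mor C. Dom C e = Dom C i \<and> Rng C e = A \<and>
        (\<forall>x\<in>Mor C. Dom C x = Dom C i \<longrightarrow> Rng C x = A \<longrightarrow> add e x x \<and> (\<exists>y\<in>Mor C. add y x e))"
    using cogroup unfolding separating_cogroup_def by (elim conjE)
  from bspec[OF this assms] show ?thesis unfolding pts_def by blast
qed

lemma separating:
  assumes "f \<in> Mor C" "g \<in> Mor C" "Dom C f = Dom C g" "Rng C f = Rng C g"
    and "\<And>x. x \<in> pts (Dom C f) \<Longrightarrow> Cmp C f x = Cmp C g x"
  shows "f = g"
proof -
  have "Cmp C g x = Some u" if "Dom C x = Dom C i" "Cmp C f x = Some u" for x u
    using assms(5)[of x] Cmp_Mor[OF that(2)] Cmp_ends[OF that(2)] that by (auto simp: pts_def)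
  then show ?thesis using separating' assms(1-4) by blast
qed

section \<open>The commutative group Hom(Z, A)\<close>

lemma add_ex:
  assumes "x \<in> pts A" "y \<in> pts A"
  obtains z where "add x y z"
proof -
  obtain m where m: "m \<in> Mor C" "Cmp C m i = Some x" "Cmp C m j = Some y"
    using copair_ex assms by blast
  have "Dom C m = Rng C d" using Cmp_ends(3)[OF m(2)] ends by simp
  then obtain z where "Cmp C m d = Some z" using Cmp_ex m(1) mors by blast
  then show thesis using that m unfolding cogroup_add_def by blast
qed

text \<open>The copairing is determined by \<open>x\<close> and \<open>y\<close>, hence so is its
  composite with \<open>d\<close>.\<close>

lemma add_unique:
  assumes "add x y z" "add x y z'" shows "z = z'"
  using assms copair_unique unfolding cogroup_add_def by (metis option.inject)

text \<open>The product does not mention \<open>A\<close>, since summands already determine their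
  codomain. The sentence asserts only that a neutral element exists over each object, so one is
  chosen.\<close>

definition hom_group :: "'o \<Rightarrow> 'm monoid" where
  "hom_group A = \<lparr>carrier = pts A, monoid.mult = (\<lambda>x y. THE z. add x y z),
     one = (SOME e. e \<in> pts A \<and> (\<forall>x\<in>pts A. add e x x \<and> (\<exists>y\<in>Mor C. add y x e)))\<rparr>"

lemma carrier_hom_group [simp]: "carrier (hom_group A) = pts A"
  by (simp add: hom_group_def)

lemma mult_hom_group: "add x y z \<Longrightarrow> x \<otimes>\<^bsub>hom_group A\<^esub> y = z"
  unfolding hom_group_def using add_unique by auto

lemma one_hom_group:
  assumes "A \<in> Obj C"
  shows "\<one>\<^bsub>hom_group A\<^esub> \<in> pts A"
    "x \<in> pts A \<Longrightarrow> add \<one>\<^bsub>hom_group A\<^esub> x x"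
    "x \<in> pts A \<Longrightarrow> \<exists>y. add y x \<one>\<^bsub>hom_group A\<^esub>"
proof -
  have "\<exists>e. e \<in> pts A \<and> (\<forall>x\<in>pts A. add e x x \<and> (\<exists>y\<in>Mor C. add y x e))"
    using add_zero_ex[OF assms] by blast
  from someI_ex[OF this]
  show "\<one>\<^bsub>hom_group A\<^esub> \<in> pts A" "x \<in> pts A \<Longrightarrow> add \<one>\<^bsub>hom_group A\<^esub> x x"
    "x \<in> pts A \<Longrightarrow> \<exists>y. add y x \<one>\<^bsub>hom_group A\<^esub>"
    unfolding hom_group_def monoid.simps by blast+
qed

lemma pts_Rng: "x \<in> pts A \<Longrightarrow> Rng C x = A"
  by (simp add: pts_def)

lemma add_mult:
  assumes "x \<in> pts A" "y \<in> pts A"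
  shows "add x y (x \<otimes>\<^bsub>hom_group A\<^esub> y)"
  using add_ex[OF assms] mult_hom_group by metis

lemma add_closed:
  assumes "x \<in> pts A" "add x y z" shows "z \<in> pts A" "y \<in> pts A"
  using add_pts[OF assms(2)] pts_Rng[OF assms(1)] pts_Rng by metis+

lemma comm_group_hom_group:
  assumes A: "A \<in> Obj C"
  shows "comm_group (hom_group A)"
proof (rule comm_groupI, unfold carrier_hom_group)
  fix x y assume x: "x \<in> pts A" and y: "y \<in> pts A"
  show xy: "x \<otimes>\<^bsub>hom_group A\<^esub> y \<in> pts A"
    using add_closed[OF x add_mult[OF x y]] by blast
  show "x \<otimes>\<^bsub>hom_group A\<^esub> y = y \<otimes>\<^bsub>hom_group A\<^esub> x"
    using mult_hom_group[OF add_comm[OF add_mult[OF y x]]] .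
  fix z assume z: "z \<in> pts A"
  have yz: "y \<otimes>\<^bsub>hom_group A\<^esub> z \<in> pts A"
    using add_closed[OF y add_mult[OF y z]] by blast
  show "x \<otimes>\<^bsub>hom_group A\<^esub> y \<otimes>\<^bsub>hom_group A\<^esub> z = x \<otimes>\<^bsub>hom_group A\<^esub> (y \<otimes>\<^bsub>hom_group A\<^esub> z)"
    using mult_hom_group[OF add_assoc[OF add_mult[OF x y] add_mult[OF xy z] add_mult[OF y z]]] by simp
next
  show "\<one>\<^bsub>hom_group A\<^esub> \<in> pts A" using one_hom_group[OF A] by blast
  fix x assume x: "x \<in> pts A"
  show "\<one>\<^bsub>hom_group A\<^esub> \<otimes>\<^bsub>hom_group A\<^esub> x = x"
    using mult_hom_group one_hom_group(2)[OF A x] by blast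
  obtain y where y: "add y x \<one>\<^bsub>hom_group A\<^esub>" using one_hom_group(3)[OF A x] by blast
  then have "y \<in> pts A" using add_closed(2)[OF x add_comm] by blast
  then show "\<exists>y\<in>pts A. y \<otimes>\<^bsub>hom_group A\<^esub> x = \<one>\<^bsub>hom_group A\<^esub>"
    using mult_hom_group[OF y] by blast
qed

section \<open>The action of Hom(Z, -) on morphisms\<close>

definition post :: "'m \<Rightarrow> 'm \<Rightarrow> 'm" where
  "post f x = the (Cmp C f x)"

lemma Cmp_post:
  assumes "f \<in> Mor C" "x \<in> pts (Dom C f)"
  shows "Cmp C f x = Some (post f x)"
  using Cmp_ex[of f x] assms unfolding post_def pts_def by force

lemma post_pts:
  assumes "f \<in> Mor C" "x \<in> pts (Dom C f)"
  shows "post f x \<in> pts (Rng C f)"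
  using Cmp_Mor[OF Cmp_post[OF assms]] Cmp_ends[OF Cmp_post[OF assms]] assms by (simp add: pts_def)

text \<open>If \<open>m\<close> is the copairing of \<open>x\<close> and \<open>y\<close>, then by
  associativity \<open>f\<close> after \<open>m\<close> is the copairing of their images, and
  composing it with \<open>d\<close> gives the image of \<open>z\<close>. Thus postcomposition is
  additive for every morphism.\<close>

lemma add_post:
  assumes f: "f \<in> Mor C" and z: "z \<in> pts (Dom C f)" and add: "add x y z"
  shows "add (post f x) (post f y) (post f z)"
proof -
  have xy: "x \<in> pts (Dom C f)" "y \<in> pts (Dom C f)"
    using add_pts[OF add] pts_Rng[OF z] by auto
  obtain m where m: "m \<in> Mor C" "Cmp C m i = Some x" "Cmp C m j = Some y" "Cmp C m d = Some z"
    using add unfolding cogroup_add_def by blast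
  have "Dom C f = Rng C m" using Cmp_ends(2)[OF m(4)] pts_Rng[OF z] by simp
  then obtain fm where fm: "Cmp C f m = Some fm" using Cmp_ex[OF f m(1)] by blast
  have "Cmp C fm i = Some (post f x)" "Cmp C fm j = Some (post f y)" "Cmp C fm d = Some (post f z)"
    using Cmp_assoc[OF fm m(2)] Cmp_assoc[OF fm m(3)] Cmp_assoc[OF fm m(4)] Cmp_post[OF f] xy z
    by simp_all
  then show ?thesis using Cmp_Mor(3)[OF fm] unfolding cogroup_add_def by blast
qed

lemma post_hom:
  assumes f: "f \<in> Mor C"
  shows "post f \<in> hom (hom_group (Dom C f)) (hom_group (Rng C f))"
  unfolding hom_def
proof (clarsimp, intro conjI ballI)
  show "post f \<in> pts (Dom C f) \<rightarrow> pts (Rng C f)" using post_pts[OF f] by blast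
  fix x y assume xy: "x \<in> pts (Dom C f)" "y \<in> pts (Dom C f)"
  let ?z = "x \<otimes>\<^bsub>hom_group (Dom C f)\<^esub> y"
  have "?z \<in> pts (Dom C f)" using add_closed(1)[OF xy(1) add_mult[OF xy]] .
  then show "post f ?z = post f x \<otimes>\<^bsub>hom_group (Rng C f)\<^esub> post f y"
    using mult_hom_group[OF add_post[OF f _ add_mult[OF xy]]] by simp
qed

lemma post_Cmp:
  assumes gf: "Cmp C g f = Some h" and x: "x \<in> pts (Dom C f)"
  shows "post h x = post g (post f x)"
  using Cmp_assoc[OF gf Cmp_post[OF Cmp_Mor(2)[OF gf] x]] by (simp add: post_def)

lemma post_Idm:
  assumes "A \<in> Obj C" "x \<in> pts A" shows "post (Idm C A) x = x"
  using Idm_laws(3)[of x] assms(2) by (simp add: pts_def post_def)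

lemma pts_nonempty: "A \<in> Obj C \<Longrightarrow> pts A \<noteq> {}"
  using add_zero_ex by blast

end

section \<open>The embedding\<close>

context universe begin

lemma embeds_Ab:
  fixes C :: "('v, 'v) lcat"
  assumes small: "small U C" and "cogroup_category C i j d"
  shows "embeds C (Ab U)"
proof -
  interpret cogroup_category C i j d by fact
  define F where "F A = code_group (hom_group A)" for A
  define G where "G f = code_hom (hom_group (Dom C f)) (hom_group (Rng C f)) (post f)" for f
  \<comment> \<open>Smallness of \<open>C\<close> is used here: each \<open>pts A\<close> is a
    subset of a small set, so the group on it is an object of \<open>Ab U\<close>.\<close>
  have "usmall (Mor C)" using small unfolding small_def usmall_def by blast
  then have "usmall (pts A)" for A by (rule usmall_subset) (auto simp: pts_def)
  then have ab: "hom_group A \<in> ab_groups U" if "A \<in> Obj C" for A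
    using comm_group_hom_group[OF that] unfolding ab_groups_def usmall_def by simp
  note abM = ab[OF Dom_Obj] ab[OF Rng_Obj]
  have injF: "A = B" if "A \<in> Obj C" "B \<in> Obj C" "F A = F B" for A B
  proof -
    have "pts A = pts B" using code_group_eqD(1)[of "hom_group A" "hom_group B"] that ab
      by (simp add: F_def)
    then show ?thesis using pts_nonempty[OF that(1)] pts_Rng by blast
  qed
  have "is_functor C (Ab U) F G"
    unfolding is_functor_def
  proof (intro conjI category category_Ab ballI allI impI)
    show "F \<in> Obj C \<rightarrow> Obj (Ab U)" using ab by (simp add: F_def)
    show "G \<in> Mor C \<rightarrow> Mor (Ab U)" using abM post_hom by (simp add: G_def hom_codesI)
    fix f
    show "Dom (Ab U) (G f) = F (Dom C f)" "Rng (Ab U) (G f) = F (Rng C f)"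
      by (simp_all add: F_def G_def)
  next
    fix A assume A: "A \<in> Obj C"
    show "G (Idm C A) = Idm (Ab U) (F A)"
      unfolding F_def G_def Idm_Ab[OF ab[OF A]] Idm_laws(1,2)[OF A]
      using post_Idm[OF A] by (intro code_hom_cong) simp_all
  next
    fix g f h assume gf: "Cmp C g f = Some h"
    note M = Cmp_Mor[OF gf] and E = Cmp_ends[OF gf]
    have "Cmp (Ab U) (G g) (G f) =
        Some (code_hom (hom_group (Dom C f)) (hom_group (Rng C g)) (\<lambda>x. post g (post f x)))"
      using Cmp_Ab[OF abM(1)[OF M(2)] abM(2)[OF M(2)] abM(2)[OF M(1)] post_hom[OF M(2)]]
        post_hom[OF M(1)] E(3) by (simp add: G_def)
    also have "\<dots> = Some (G h)"
      unfolding G_def E(1,2) using post_Cmp[OF gf] by (intro arg_cong[of _ _ Some] code_hom_cong) simp_all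
    finally show "Cmp (Ab U) (G g) (G f) = Some (G h)" .
  qed
  moreover have "inj_on F (Obj C)" using injF by (rule inj_onI)
  moreover have "inj_on G (Mor C)"
  proof (rule inj_onI)
    fix f g assume f: "f \<in> Mor C" and g: "g \<in> Mor C" and eq: "G f = G g"
    \<comment> \<open>Separation compares only parallel morphisms. The ends are recovered first,
      from the source and target stored in the code and the injectivity of \<open>F\<close>.\<close>
    have "F (Dom C f) = F (Dom C g)" "F (Rng C f) = F (Rng C g)"
      using arg_cong[OF eq, of source] arg_cong[OF eq, of target] by (simp_all add: F_def G_def)
    then have E: "Dom C f = Dom C g" "Rng C f = Rng C g"
      using injF Dom_Obj Rng_Obj f g by blast+
    show "f = g"
    proof (rule separating[OF f g E])
      fix x assume x: "x \<in> pts (Dom C f)"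
      have "post f x = post g x"
        by (rule code_hom_eqD[OF eq[unfolded G_def] _ abM(1)[OF f] abM(2)[OF f] post_hom[OF f]
              abM(1)[OF g] abM(2)[OF g] post_hom[OF g]])
          (simp add: x)
      then show "Cmp C f x = Cmp C g x" using Cmp_post f g x E by simp
    qed
  qed
  ultimately show ?thesis unfolding embeds_def by blast
qed

end

section \<open>The separating cogroup of the category of Abelian groups\<close>

text \<open>The direct sum of two copies of \<open>Z\<close>, built on Kuratowski pairs so that its
  elements are again sets of type \<open>'v\<close> and it can be an object of
  \<open>Ab U\<close>.\<close>

definition square_group :: "'v::sets monoid \<Rightarrow> 'v monoid" where
  "square_group Z = \<lparr>carrier = {vpair a b |a b. a \<in> carrier Z \<and> b \<in> carrier Z},
     monoid.mult = (\<lambda>p q. vpair (vfst p \<otimes>\<^bsub>Z\<^esub> vfst q) (vsnd p \<otimes>\<^bsub>Z\<^esub> vsnd q)),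
     one = vpair \<one>\<^bsub>Z\<^esub> \<one>\<^bsub>Z\<^esub>\<rparr>"

lemma square_group_simps [simp]:
  "vpair a b \<in> carrier (square_group Z) \<longleftrightarrow> a \<in> carrier Z \<and> b \<in> carrier Z"
  "vpair a b \<otimes>\<^bsub>square_group Z\<^esub> vpair c d = vpair (a \<otimes>\<^bsub>Z\<^esub> c) (b \<otimes>\<^bsub>Z\<^esub> d)"
  "\<one>\<^bsub>square_group Z\<^esub> = vpair \<one>\<^bsub>Z\<^esub> \<one>\<^bsub>Z\<^esub>"
  by (auto simp: square_group_def)

lemma square_groupE:
  assumes "p \<in> carrier (square_group Z)"
  obtains a b where "p = vpair a b" "a \<in> carrier Z" "b \<in> carrier Z"
  using assms by (auto simp: square_group_def)

lemma comm_group_square_group: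
  assumes "comm_group Z" shows "comm_group (square_group Z)"
proof -
  interpret comm_group Z by fact
  show ?thesis
  proof (rule comm_groupI)
    fix p assume "p \<in> carrier (square_group Z)"
    then obtain a b where p: "p = vpair a b" "a \<in> carrier Z" "b \<in> carrier Z" by (rule square_groupE)
    then have "vpair (inv\<^bsub>Z\<^esub> a) (inv\<^bsub>Z\<^esub> b) \<otimes>\<^bsub>square_group Z\<^esub> p = \<one>\<^bsub>square_group Z\<^esub>"
      by simp
    then show "\<exists>q\<in>carrier (square_group Z). q \<otimes>\<^bsub>square_group Z\<^esub> p = \<one>\<^bsub>square_group Z\<^esub>"
      using p by (meson inv_closed square_group_simps(1))
  qed (auto elim!: square_groupE simp: m_assoc intro: m_comm)
qed

text \<open>\<open>Z\<close> is the additive group of integers transported along \<open>e\<close>.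
  The homomorphism sends \<open>e k\<close> to the k-th power of \<open>a\<close>, so the generator
  \<open>e 1\<close> is mapped to \<open>a\<close>.\<close>

lemma int_pow_generator:
  assumes "group A" "inj e"
    and Z: "Z = \<lparr>carrier = range e,
      monoid.mult = (\<lambda>x y. e (inv_into UNIV e x + inv_into UNIV e y)), one = e (0::int)\<rparr>"
    and "a \<in> carrier A"
  shows "\<exists>h\<in>hom Z A. a \<in> h ` carrier Z"
proof
  interpret A: group A by fact
  let ?h = "\<lambda>x. a [^]\<^bsub>A\<^esub> inv_into UNIV e x"
  show "?h \<in> hom Z A"
    using assms(2,4) by (auto simp: hom_def Z A.int_pow_mult)
  have "?h (e 1) = a" using assms(2,4) by simp
  then show "a \<in> ?h ` carrier Z" by (intro image_eqI[of _ _ "e 1"]) (simp_all add: Z)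
qed

context universe begin

lemma square_group_ab:
  assumes "Z \<in> ab_groups U" shows "square_group Z \<in> ab_groups U"
proof -
  have "usmall (carrier (square_group Z))"
    using usmall_Times[OF ab_groupsD(2)[OF assms] ab_groupsD(2)[OF assms]]
    by (simp add: square_group_def)
  then show ?thesis
    using comm_group_square_group[OF ab_groupsD(1)[OF assms]]
    unfolding ab_groups_def usmall_def by blast
qed

text \<open>The integers need a carrier inside the universe: \<open>int_encode\<close> numbers them
  by naturals, which are then replaced by the numerals of \<omega>. Reaching every element of every
  group by a homomorphism from \<open>Z\<close> is what makes \<open>Z\<close> separating.\<close>

lemma separating_group:
  obtains Z where "Z \<in> ab_groups U"
    "\<And>A a. A \<in> ab_groups U \<Longrightarrow> a \<in> carrier A \<Longrightarrow> \<exists>h\<in>hom Z A. a \<in> h ` carrier Z"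
proof -
  obtain num :: "nat \<Rightarrow> 'v" where num: "inj num" "usmall (range num)"
    by (rule usmall_countably_infinite)
  define e where "e = num \<circ> int_encode"
  define Z where "Z = \<lparr>carrier = range e,
      monoid.mult = (\<lambda>x y. e (inv_into UNIV e x + inv_into UNIV e y)), one = e (0::int)\<rparr>"
  have inj: "inj e" unfolding e_def using num(1) inj_int_encode by (simp add: inj_compose)
  have "comm_group Z"
  proof (rule comm_groupI)
    fix x assume "x \<in> carrier Z"
    then obtain k where "x = e k" by (auto simp: Z_def)
    then show "\<exists>y\<in>carrier Z. y \<otimes>\<^bsub>Z\<^esub> x = \<one>\<^bsub>Z\<^esub>"
      using inj by (intro bexI[of _ "e (- k)"]) (simp_all add: Z_def)
  qed (use inj in \<open>auto simp: Z_def add_ac\<close>)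
  moreover have "usmall (carrier Z)"
    using num(2) by (rule usmall_subset) (auto simp: Z_def e_def)
  ultimately have "Z \<in> ab_groups U" unfolding ab_groups_def usmall_def by blast
  moreover have "\<exists>h\<in>hom Z A. a \<in> h ` carrier Z" if "A \<in> ab_groups U" "a \<in> carrier A" for A a
    using int_pow_generator[OF _ inj Z_def that(2)] ab_groupsD(1)[OF that(1)]
    by (simp add: comm_group.axioms(2))
  ultimately show thesis by (rule that)
qed

end

section \<open>The cogroup structure on a group of the universe\<close>

locale ab_cogroup = universe U for U :: "'v::sets set" +
  fixes Z :: "'v monoid"
  assumes Z: "Z \<in> ab_groups U"
begin

abbreviation W where "W \<equiv> square_group Z"

definition coproj1 where "coproj1 = code_hom Z W (\<lambda>a. vpair a \<one>\<^bsub>Z\<^esub>)"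
definition coproj2 where "coproj2 = code_hom Z W (\<lambda>a. vpair \<one>\<^bsub>Z\<^esub> a)"
definition diagonal where "diagonal = code_hom Z W (\<lambda>a. vpair a a)"

sublocale Z: comm_group Z using Z by (rule ab_groupsD)

lemma W: "W \<in> ab_groups U" using Z by (rule square_group_ab)

lemma coproj_hom:
  "(\<lambda>a. vpair a \<one>\<^bsub>Z\<^esub>) \<in> hom Z W" "(\<lambda>a. vpair \<one>\<^bsub>Z\<^esub> a) \<in> hom Z W" "(\<lambda>a. vpair a a) \<in> hom Z W"
  by (auto simp: hom_def)

lemma coproj_Mor:
  "coproj1 \<in> hom_codes U" "coproj2 \<in> hom_codes U" "diagonal \<in> hom_codes U"
  unfolding coproj1_def coproj2_def diagonal_def using Z W coproj_hom by (simp_all add: hom_codesI)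

lemma coproj_ends [simp]:
  "source coproj1 = code_group Z" "source coproj2 = code_group Z" "source diagonal = code_group Z"
  "target coproj1 = code_group W" "target coproj2 = code_group W" "target diagonal = code_group W"
  by (simp_all add: coproj1_def coproj2_def diagonal_def)

lemma Cmp_coproj:
  assumes "A \<in> ab_groups U" "p \<in> hom W A"
  shows "Cmp (Ab U) (code_hom W A p) coproj1 = Some (code_hom Z A (\<lambda>a. p (vpair a \<one>\<^bsub>Z\<^esub>)))"
    "Cmp (Ab U) (code_hom W A p) coproj2 = Some (code_hom Z A (\<lambda>a. p (vpair \<one>\<^bsub>Z\<^esub> a)))"
    "Cmp (Ab U) (code_hom W A p) diagonal = Some (code_hom Z A (\<lambda>a. p (vpair a a)))"
  unfolding coproj1_def coproj2_def diagonal_def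
  using Cmp_Ab[OF Z W assms(1) _ assms(2)] coproj_hom by simp_all

text \<open>In \<open>W\<close> the pair (a, b) is the product of (a, 1) and (1, b). This yields
  uniqueness of copairings, and for a = b it shows that restricting to the diagonal multiplies the
  two components pointwise.\<close>

lemma hom_W_split:
  assumes "p \<in> hom W A" "a \<in> carrier Z" "b \<in> carrier Z"
  shows "p (vpair a b) = p (vpair a \<one>\<^bsub>Z\<^esub>) \<otimes>\<^bsub>A\<^esub> p (vpair \<one>\<^bsub>Z\<^esub> b)"
  using hom_mult[OF assms(1), of "vpair a \<one>\<^bsub>Z\<^esub>" "vpair \<one>\<^bsub>Z\<^esub> b"] assms by simp

text \<open>The copairing sends (a, b) to the product of \<open>f a\<close> and \<open>g b\<close>;
  commutativity of \<open>A\<close> makes it a homomorphism.\<close>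

lemma copairing:
  assumes A: "A \<in> ab_groups U" and f: "f \<in> hom Z A" and g: "g \<in> hom Z A"
  shows "\<exists>m\<in>hom_codes U. Cmp (Ab U) m coproj1 = Some (code_hom Z A f) \<and>
    Cmp (Ab U) m coproj2 = Some (code_hom Z A g) \<and>
    Cmp (Ab U) m diagonal = Some (code_hom Z A (\<lambda>a. f a \<otimes>\<^bsub>A\<^esub> g a))"
proof -
  interpret A: comm_group A using A by (rule ab_groupsD)
  interpret f: group_hom Z A f by unfold_locales fact
  interpret g: group_hom Z A g by unfold_locales fact
  define p where "p q = f (vfst q) \<otimes>\<^bsub>A\<^esub> g (vsnd q)" for q
  have p: "p \<in> hom W A"
    by (rule homI) (auto elim!: square_groupE simp: p_def A.m_ac)
  show ?thesis
  proof (intro bexI conjI)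
    show "code_hom W A p \<in> hom_codes U" using W A p by (rule hom_codesI)
    show "Cmp (Ab U) (code_hom W A p) coproj1 = Some (code_hom Z A f)"
      "Cmp (Ab U) (code_hom W A p) coproj2 = Some (code_hom Z A g)"
      "Cmp (Ab U) (code_hom W A p) diagonal = Some (code_hom Z A (\<lambda>a. f a \<otimes>\<^bsub>A\<^esub> g a))"
      unfolding Cmp_coproj[OF A p] p_def
      by (intro arg_cong[of _ _ Some] code_hom_cong; simp)+
  qed
qed

lemma coproj1_decompose:
  assumes m: "Cmp (Ab U) m coproj1 = Some x"
  obtains A p where "A \<in> ab_groups U" "p \<in> hom W A" "m = code_hom W A p" "target x = code_group A"
proof -
  note M = Cmp_AbD[OF m]
  obtain A where A: "A \<in> ab_groups U" "target m = code_group A" using M(1) by (auto elim: hom_codesE)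
  obtain p where p: "p \<in> hom W A" "m = code_hom W A p"
    using hom_codes_betweenE[OF M(1) _ A(2) W A(1)] M(3) by auto
  have "target x = code_group A" using m Cmp_coproj(1)[OF A(1) p(1)] p(2) by auto
  then show thesis using that A p by blast
qed

lemma cogroup_addI:
  assumes "A \<in> ab_groups U" "f \<in> hom Z A" "g \<in> hom Z A"
    and "\<And>a. a \<in> carrier Z \<Longrightarrow> h a = f a \<otimes>\<^bsub>A\<^esub> g a"
  shows "cogroup_add (Ab U) coproj1 coproj2 diagonal (code_hom Z A f) (code_hom Z A g) (code_hom Z A h)"
proof -
  have "code_hom Z A h = code_hom Z A (\<lambda>a. f a \<otimes>\<^bsub>A\<^esub> g a)"
    using assms(4) by (intro code_hom_cong) simp_all
  then show ?thesis using copairing[OF assms(1-3)] by (simp add: cogroup_add_def)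
qed

text \<open>Together with \<open>cogroup_addI\<close> this identifies the abstract sum with
  pointwise multiplication. The value of \<open>h\<close> at a is that of the copairing at (a, a),
  which \<open>hom_W_split\<close> factors.\<close>

lemma cogroup_addE:
  assumes "cogroup_add (Ab U) coproj1 coproj2 diagonal x y z"
  obtains A f g h where "A \<in> ab_groups U" "f \<in> hom Z A" "g \<in> hom Z A" "h \<in> hom Z A"
    "x = code_hom Z A f" "y = code_hom Z A g" "z = code_hom Z A h"
    "\<And>a. a \<in> carrier Z \<Longrightarrow> h a = f a \<otimes>\<^bsub>A\<^esub> g a"
proof -
  obtain m where m: "Cmp (Ab U) m coproj1 = Some x" "Cmp (Ab U) m coproj2 = Some y"
      "Cmp (Ab U) m diagonal = Some z"
    using assms unfolding cogroup_add_def by blast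
  obtain A p where p: "A \<in> ab_groups U" "p \<in> hom W A" "m = code_hom W A p"
    using coproj1_decompose[OF m(1)] by blast
  note homs = coproj_hom(1)[THEN hom_compose_fun, OF p(2)] coproj_hom(2)[THEN hom_compose_fun, OF p(2)]
    coproj_hom(3)[THEN hom_compose_fun, OF p(2)]
  have "x = code_hom Z A (\<lambda>a. p (vpair a \<one>\<^bsub>Z\<^esub>))" "y = code_hom Z A (\<lambda>a. p (vpair \<one>\<^bsub>Z\<^esub> a))"
    "z = code_hom Z A (\<lambda>a. p (vpair a a))"
    using m unfolding p(3) Cmp_coproj[OF p(1,2)] by simp_all
  then show thesis by (rule that[OF p(1) homs]) (rule hom_W_split[OF p(2)])
qed

lemma code_hom_Z_eqD:
  assumes "code_hom Z A f = code_hom Z B g" "A \<in> ab_groups U" "B \<in> ab_groups U"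
    and "f \<in> hom Z A" "g \<in> hom Z B" "a \<in> carrier Z"
  shows "f a = g a"
  using code_hom_eqD[OF assms(1,6) Z assms(2,4) Z assms(3,5)] .

text \<open>Sums that share a summand must be expanded over one and the same record
  \<open>A\<close>. The target of any of the three morphisms fixes the code of the group, which
  suffices for the exchange.\<close>

lemma cogroup_addE_target:
  assumes "cogroup_add (Ab U) coproj1 coproj2 diagonal x y z"
    and A: "A \<in> ab_groups U" "target x = code_group A \<or> target y = code_group A \<or> target z = code_group A"
  obtains f g h where "f \<in> hom Z A" "g \<in> hom Z A" "h \<in> hom Z A"
    "x = code_hom Z A f" "y = code_hom Z A g" "z = code_hom Z A h"
    "\<And>a. a \<in> carrier Z \<Longrightarrow> h a = f a \<otimes>\<^bsub>A\<^esub> g a"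
proof -
  obtain B f g h where B: "B \<in> ab_groups U" "f \<in> hom Z B" "g \<in> hom Z B" "h \<in> hom Z B"
    "x = code_hom Z B f" "y = code_hom Z B g" "z = code_hom Z B h"
    "\<And>a. a \<in> carrier Z \<Longrightarrow> h a = f a \<otimes>\<^bsub>B\<^esub> g a"
    using assms(1) by (rule cogroup_addE) blast
  have eq: "code_group B = code_group A" using A(2) B(5-7) by auto
  have hom: "hom Z B = hom Z A" using code_group_eq_hom[OF Z Z refl B(1) A(1) eq] .
  have code: "code_hom Z B k = code_hom Z A k" for k using eq by (intro code_hom_cong) simp_all
  have "h a = f a \<otimes>\<^bsub>A\<^esub> g a" if "a \<in> carrier Z" for a
    using B(8)[OF that] code_group_eqD(3)[OF B(1) A(1) eq] B(2,3) that by (simp add: hom_def Pi_iff)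
  then show thesis using that[of f g h] B(2-7) hom code by simp
qed

lemma separating_cogroup_Ab:
  assumes sep: "\<And>A a. A \<in> ab_groups U \<Longrightarrow> a \<in> carrier A \<Longrightarrow> \<exists>h\<in>hom Z A. a \<in> h ` carrier Z"
  shows "separating_cogroup (Ab U) coproj1 coproj2 diagonal"
  unfolding separating_cogroup_def Ab_simps coproj_ends
proof (intro conjI ballI impI refl)
  fix x y assume x: "x \<in> hom_codes U" "source x = code_group Z"
    and y: "y \<in> hom_codes U" "source y = code_group Z" and xy: "target x = target y"
  obtain A where A: "A \<in> ab_groups U" "target x = code_group A" using x(1) by (auto elim: hom_codesE)
  obtain f g where "f \<in> hom Z A" "x = code_hom Z A f" "g \<in> hom Z A" "y = code_hom Z A g"
    using hom_codes_betweenE[OF x A(2) Z A(1)] hom_codes_betweenE[OF y _ Z A(1)] xy A(2) by metis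
  then show "\<exists>m\<in>hom_codes U. Cmp (Ab U) m coproj1 = Some x \<and> Cmp (Ab U) m coproj2 = Some y"
    using copairing[OF A(1)] by blast
next
  fix m n x y
  assume m: "Cmp (Ab U) m coproj1 = Some x" "Cmp (Ab U) m coproj2 = Some y"
    and n: "Cmp (Ab U) n coproj1 = Some x" "Cmp (Ab U) n coproj2 = Some y"
  obtain A p where p: "A \<in> ab_groups U" "p \<in> hom W A" "m = code_hom W A p" "target x = code_group A"
    using coproj1_decompose[OF m(1)] by blast
  \<comment> \<open>Both \<open>m\<close> and \<open>n\<close> have the target of \<open>x\<close>,
    so \<open>n\<close> can be rewritten over the same \<open>W\<close> and \<open>A\<close> as
    \<open>m\<close>.\<close>
  obtain B where B: "B \<in> ab_groups U" "target n = code_group B" "target x = code_group B"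
    using coproj1_decompose[OF n(1)] target_code_hom by metis
  obtain q where q: "q \<in> hom W A" "n = code_hom W A q"
    using hom_codes_betweenE[OF Cmp_AbD(1)[OF n(1)] _ _ W p(1)] Cmp_AbD(3)[OF n(1)] p(4) B by auto
  have "p (vpair a \<one>\<^bsub>Z\<^esub>) = q (vpair a \<one>\<^bsub>Z\<^esub>)" "p (vpair \<one>\<^bsub>Z\<^esub> a) = q (vpair \<one>\<^bsub>Z\<^esub> a)"
    if "a \<in> carrier Z" for a
  proof -
    note hom1 = coproj_hom(1)[THEN hom_compose_fun] and hom2 = coproj_hom(2)[THEN hom_compose_fun]
    have "code_hom Z A (\<lambda>a. p (vpair a \<one>\<^bsub>Z\<^esub>)) = code_hom Z A (\<lambda>a. q (vpair a \<one>\<^bsub>Z\<^esub>))"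
      using m(1) n(1) unfolding p(3) q(2) Cmp_coproj(1)[OF p(1,2)] Cmp_coproj(1)[OF p(1) q(1)] by simp
    from code_hom_Z_eqD[OF this p(1) p(1) hom1[OF p(2)] hom1[OF q(1)] that]
    show "p (vpair a \<one>\<^bsub>Z\<^esub>) = q (vpair a \<one>\<^bsub>Z\<^esub>)" .
    have "code_hom Z A (\<lambda>a. p (vpair \<one>\<^bsub>Z\<^esub> a)) = code_hom Z A (\<lambda>a. q (vpair \<one>\<^bsub>Z\<^esub> a))"
      using m(2) n(2) unfolding p(3) q(2) Cmp_coproj(2)[OF p(1,2)] Cmp_coproj(2)[OF p(1) q(1)] by simp
    from code_hom_Z_eqD[OF this p(1) p(1) hom2[OF p(2)] hom2[OF q(1)] that]
    show "p (vpair \<one>\<^bsub>Z\<^esub> a) = q (vpair \<one>\<^bsub>Z\<^esub> a)" .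
  qed
  then have "p r = q r" if "r \<in> carrier W" for r
    using that hom_W_split[OF p(2)] hom_W_split[OF q(1)] by (metis square_groupE)
  then show "m = n" unfolding p(3) q(2) by (intro code_hom_cong) simp_all
next
  fix x y z u v w
  assume xy: "cogroup_add (Ab U) coproj1 coproj2 diagonal x y u"
    and uz: "cogroup_add (Ab U) coproj1 coproj2 diagonal u z w"
    and yz: "cogroup_add (Ab U) coproj1 coproj2 diagonal y z v"
  obtain A f g h where 1: "A \<in> ab_groups U" "f \<in> hom Z A" "g \<in> hom Z A" "h \<in> hom Z A"
    "x = code_hom Z A f" "y = code_hom Z A g" "u = code_hom Z A h"
    "\<And>a. a \<in> carrier Z \<Longrightarrow> h a = f a \<otimes>\<^bsub>A\<^esub> g a"
    using xy by (rule cogroup_addE) blast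
  obtain h' k l where 2: "h' \<in> hom Z A" "k \<in> hom Z A" "l \<in> hom Z A"
    "u = code_hom Z A h'" "z = code_hom Z A k" "w = code_hom Z A l"
    "\<And>a. a \<in> carrier Z \<Longrightarrow> l a = h' a \<otimes>\<^bsub>A\<^esub> k a"
    using cogroup_addE_target[OF uz 1(1)] 1(7) by auto
  obtain g' k' n where 3: "g' \<in> hom Z A" "k' \<in> hom Z A" "n \<in> hom Z A"
    "y = code_hom Z A g'" "z = code_hom Z A k'" "v = code_hom Z A n"
    "\<And>a. a \<in> carrier Z \<Longrightarrow> n a = g' a \<otimes>\<^bsub>A\<^esub> k' a"
    using cogroup_addE_target[OF yz 1(1)] 1(6) by auto
  interpret A: comm_group A using 1(1) by (rule ab_groupsD)
  show "cogroup_add (Ab U) coproj1 coproj2 diagonal x v w"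
    unfolding 1(5) 2(6) 3(6)
  proof (rule cogroup_addI[OF 1(1,2) 3(3)])
    fix a assume a: "a \<in> carrier Z"
    \<comment> \<open>The morphisms \<open>u\<close>, \<open>y\<close> and \<open>z\<close> each
      carry two representing functions by now; equal codes make these agree on the carrier of
      \<open>Z\<close>.\<close>
    note eqD = code_hom_Z_eqD[OF _ 1(1) 1(1) _ _ a]
    have "h' a = h a" "g' a = g a" "k' a = k a"
      using eqD 1 2 3 by metis+
    then show "l a = f a \<otimes>\<^bsub>A\<^esub> n a"
      using 1(8)[OF a] 2(7)[OF a] 3(7)[OF a] a 1(2,3) 2(2) by (simp add: hom_def Pi_iff A.m_assoc)
  qed
next
  fix x y z assume "cogroup_add (Ab U) coproj1 coproj2 diagonal x y z"
  then obtain A f g h where A: "A \<in> ab_groups U" "f \<in> hom Z A" "g \<in> hom Z A" "h \<in> hom Z A"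
    "x = code_hom Z A f" "y = code_hom Z A g" "z = code_hom Z A h"
    "\<And>a. a \<in> carrier Z \<Longrightarrow> h a = f a \<otimes>\<^bsub>A\<^esub> g a"
    by (rule cogroup_addE) blast
  interpret A: comm_group A using A(1) by (rule ab_groupsD)
  have "h a = g a \<otimes>\<^bsub>A\<^esub> f a" if "a \<in> carrier Z" for a
    using A(8)[OF that] A(2,3) that A.m_comm by (simp add: hom_def Pi_iff)
  then show "cogroup_add (Ab U) coproj1 coproj2 diagonal y x z"
    unfolding A(5-7) by (rule cogroup_addI[OF A(1,3,2)])
next
  fix A' assume "A' \<in> code_group ` ab_groups U"
  then obtain A where A: "A \<in> ab_groups U" "A' = code_group A" by blast
  interpret A: comm_group A using A(1) by (rule ab_groupsD)
  \<comment> \<open>The neutral point over \<open>A\<close> is the trivial homomorphism.\<close>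
  have one: "(\<lambda>_. \<one>\<^bsub>A\<^esub>) \<in> hom Z A" by (simp add: hom_def)
  have "cogroup_add (Ab U) coproj1 coproj2 diagonal (code_hom Z A (\<lambda>_. \<one>\<^bsub>A\<^esub>)) x x \<and>
      (\<exists>y\<in>hom_codes U. cogroup_add (Ab U) coproj1 coproj2 diagonal y x (code_hom Z A (\<lambda>_. \<one>\<^bsub>A\<^esub>)))"
    if x: "x \<in> hom_codes U" "source x = code_group Z" "target x = A'" for x
  proof -
    obtain f where f: "f \<in> hom Z A" "x = code_hom Z A f"
      using hom_codes_betweenE[OF x(1,2) _ Z A(1)] x(3) A(2) by blast
    then have fa: "f a \<in> carrier A" if "a \<in> carrier Z" for a using that by (auto simp: hom_def)
    \<comment> \<open>Pointwise inversion of \<open>f\<close> is again a homomorphism because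
      \<open>A\<close> is commutative; it is the inverse point.\<close>
    have inv: "(\<lambda>a. inv\<^bsub>A\<^esub> (f a)) \<in> hom Z A"
      using f(1) by (auto simp: hom_def Pi_iff A.inv_mult)
    show ?thesis
    proof (intro conjI bexI)
      show "cogroup_add (Ab U) coproj1 coproj2 diagonal (code_hom Z A (\<lambda>_. \<one>\<^bsub>A\<^esub>)) x x"
        unfolding f(2) using fa by (intro cogroup_addI A one f) simp
      show "cogroup_add (Ab U) coproj1 coproj2 diagonal (code_hom Z A (\<lambda>a. inv\<^bsub>A\<^esub> (f a))) x
          (code_hom Z A (\<lambda>_. \<one>\<^bsub>A\<^esub>))"
        unfolding f(2) using fa by (intro cogroup_addI A inv f) simp
      show "code_hom Z A (\<lambda>a. inv\<^bsub>A\<^esub> (f a)) \<in> hom_codes U"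
        using Z A(1) inv by (rule hom_codesI)
    qed
  qed
  then show "\<exists>e\<in>hom_codes U. source e = code_group Z \<and> target e = A' \<and>
      (\<forall>x\<in>hom_codes U. source x = code_group Z \<longrightarrow> target x = A' \<longrightarrow>
        cogroup_add (Ab U) coproj1 coproj2 diagonal e x x \<and>
        (\<exists>y\<in>hom_codes U. cogroup_add (Ab U) coproj1 coproj2 diagonal y x e))"
    using hom_codesI[OF Z A(1) one] A(2) by (intro bexI[of _ "code_hom Z A (\<lambda>_. \<one>\<^bsub>A\<^esub>)"]) auto
next
  fix f g
  assume fg: "f \<in> hom_codes U" "g \<in> hom_codes U" "source f = source g" "target f = target g"
    and *: "\<forall>x\<in>hom_codes U. \<forall>u\<in>hom_codes U. source x = code_group Z \<longrightarrow>
      Cmp (Ab U) f x = Some u \<longrightarrow> Cmp (Ab U) g x = Some u"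
  obtain A B p where p: "A \<in> ab_groups U" "B \<in> ab_groups U" "p \<in> hom A B" "f = code_hom A B p"
    using fg(1) by (rule hom_codesE)
  obtain q where q: "q \<in> hom A B" "g = code_hom A B q"
    using hom_codes_betweenE[OF fg(2) _ _ p(1,2)] fg p(4) by auto
  have "p a = q a" if a: "a \<in> carrier A" for a
  proof -
    \<comment> \<open>The homomorphism \<open>h\<close> is a point of \<open>A\<close> passing
      through \<open>a\<close>. By \<open>*\<close> its composites with \<open>f\<close> and
      \<open>g\<close> coincide, and evaluating them at \<open>c\<close> compares \<open>p\<close>
      and \<open>q\<close> at \<open>a\<close>.\<close>
    obtain h c where h: "h \<in> hom Z A" "c \<in> carrier Z" "a = h c" using sep[OF p(1) a] by blast
    note ph = hom_compose_fun[OF h(1) p(3)] and qh = hom_compose_fun[OF h(1) q(1)]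
    have "code_hom Z B (\<lambda>x. q (h x)) = code_hom Z B (\<lambda>x. p (h x))"
      using *[rule_format, OF hom_codesI[OF Z p(1) h(1)] hom_codesI[OF Z p(2) ph]]
      unfolding p(4) q(2) Cmp_Ab[OF Z p(1,2) h(1) p(3)] Cmp_Ab[OF Z p(1,2) h(1) q(1)] by simp
    from code_hom_Z_eqD[OF this p(2,2) qh ph h(2)] show ?thesis using h(3) by simp
  qed
  then show "f = g" unfolding p(4) q(2) by (intro code_hom_cong) simp_all
qed

end

theorem corollary1p3:
  fixes U :: "'v::sets set"
  assumes "grothendieck_universe U"
  shows "category (Ab U) \<and> universal U (Ab U)"
proof -
  interpret universe U using assms by unfold_locales
  obtain Z where Z: "Z \<in> ab_groups U"
    and sep: "\<And>A a. A \<in> ab_groups U \<Longrightarrow> a \<in> carrier A \<Longrightarrow> \<exists>h\<in>hom Z A. a \<in> h ` carrier Z"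
    using separating_group by blast
  interpret ab_cogroup U Z using Z by unfold_locales
  have "embeds C (Ab U)"
    if C: "lcat_structure C" "small U C" "elementarily_equivalent C (Ab U)" for C :: "('v, 'v) lcat"
  proof -
    have "category C" "\<exists>i\<in>Mor C. \<exists>j\<in>Mor C. \<exists>d\<in>Mor C. separating_cogroup C i j d"
      using separating_cogroup_transfer[OF C(1,3) category_Ab _ _ _ separating_cogroup_Ab[OF sep]]
        coproj_Mor by simp_all
    then obtain i j d where "cogroup_category C i j d" unfolding cogroup_category_def by blast
    then show ?thesis using embeds_Ab C(2) by blast
  qed
  then show ?thesis
    unfolding universal_def using category_Ab lcat_structure_Ab code_group_in_U
    by (auto elim!: hom_codesE intro: code_hom_in_U)
qed

end
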